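(* Let $d \geq 2$ be an integer, and let $P \in \mathcal{P}_d(d+2)$ have maximal volume over $\mathcal{P}_d(d+2)$. Then $P=\operatorname{conv}(P_1 \cup P_2)$, where $P_1$ and $P_2$ are regular simplices of dimensions $\lfloor \frac{d}{2} \rfloor$ and $\lceil \frac{d}{2} \rceil$, respectively, inscribed in $\mathbb{S}^{d-1}$, and contained in orthogonal linear subspaces of $\mathbb{R}^d$. Furthermore, \[ v_d(d+2) = \frac{1}{d!} \cdot \frac{\left( \lfloor d/2 \rfloor + 1 \right)^{\frac{\lfloor d/2 \rfloor + 1}{2}} \cdot \left( \lceil d/2 \rceil + 1 \right)^{\frac{\lceil d/2 \rceil + 1}{2}}}{\lfloor d/2 \rfloor^{\frac{\lfloor d/2 \rfloor}{2}} \cdot \lceil d/2 \rceil^{\frac{\lceil d/2 \rceil}{2} }}. \]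
   Context: $\mathbb{S}^{d-1}$ is the unit sphere of $\mathbb{R}^d$ centered at the origin $o$. A polytope means a convex polytope. A polytope is inscribed in $\mathbb{S}^{d-1}$ if all its vertices lie on $\mathbb{S}^{d-1}$. $\mathcal{P}_d(n)$ denotes the family of $d$-dimensional polytopes in $\mathbb{R}^d$ with exactly $n$ vertices, inscribed in $\mathbb{S}^{d-1}$. $\operatorname{vol}_d$ is $d$-dimensional volume, and $v_d(n) = \max \{ \operatorname{vol}_d(P) : P \in \mathcal{P}_d(n) \}$. *)

theory Defs
  imports "HOL-Analysis.Analysis"
begin

definition vertices :: "'a::euclidean_space set \<Rightarrow> 'a set" where
  "vertices S = {v. v extreme_point_of S}"

definition inscribed :: "'a::euclidean_space set \<Rightarrow> bool" where
  "inscribed S \<longleftrightarrow> vertices S \<subseteq> sphere 0 1"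

text \<open>The family \<open>P\<^sub>d(n)\<close>, with \<open>d\<close> given by the size of the index type.\<close>

definition inscribed_polytopes :: "nat \<Rightarrow> (real ^ 'n) set set" where
  "inscribed_polytopes n =
     {P. polytope P \<and> aff_dim P = int CARD('n) \<and> card (vertices P) = n \<and> inscribed P}"

definition has_maximal_volume :: "'a::euclidean_space set \<Rightarrow> 'a set set \<Rightarrow> bool" where
  "has_maximal_volume P F \<longleftrightarrow> P \<in> F \<and> (\<forall>Q\<in>F. measure lebesgue Q \<le> measure lebesgue P)"

text \<open>The quantity \<open>v\<^sub>d(n)\<close>. Like any \<open>GREATEST\<close> term, it is meaningful only if the maximum is
  attained; see \<^const>\<open>has_maximal_volume\<close>.\<close>

definition max_volume :: "'n::finite itself \<Rightarrow> nat \<Rightarrow> real" where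
  "max_volume _ n =
     (GREATEST V. \<exists>P \<in> (inscribed_polytopes n :: (real ^ 'n) set set). V = measure lebesgue P)"

definition regular_simplex :: "nat \<Rightarrow> 'a::euclidean_space set \<Rightarrow> bool" where
  "regular_simplex k S \<longleftrightarrow> int k simplex S \<and>
     (\<exists>l. \<forall>u\<in>vertices S. \<forall>v\<in>vertices S. u \<noteq> v \<longrightarrow> dist u v = l)"

definition orthogonal_subspaces :: "'a::euclidean_space set \<Rightarrow> 'a set \<Rightarrow> bool" where
  "orthogonal_subspaces U V \<longleftrightarrow>
     subspace U \<and> subspace V \<and> (\<forall>u\<in>U. \<forall>v\<in>V. orthogonal u v)"

end

theory Submission
  imports Defs
begin

text \<open>
  Let \<open>p\<close> be the family of the \<open>d + 2\<close> vertices of an inscribed polytope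
  \<open>P\<close>.  The vertices have an affine dependence with coefficients \<open>c\<close>; let
  \<open>A\<close> be the set of vertices with positive coefficient.  Since no vertex is a convex
  combination of the others, \<open>A\<close> and its complement have at least two elements, say
  \<open>s + 1\<close> and \<open>t + 1\<close> with \<open>s + t = d\<close>.  The polytope is covered by
  the simplices that omit one vertex of \<open>A\<close>
  (\<open>convex_hull_cover_omit_vertex\<close>).

  The sum of their volumes is a single determinant.  Append to each vertex two coordinates,
  \<open>(1 / sqrt s, 0)\<close> on \<open>A\<close> and \<open>(0, 1 / sqrt t)\<close> off
  \<open>A\<close>.  By Cramer's rule the simplex without vertex \<open>i\<close> has volume
  proportional to \<open>c i\<close>, and the volumes add up to
  \<open>\<bar>det N\<bar> * sqrt s * sqrt t / d!\<close>, where \<open>N\<close> is the square matrix of the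
  lifted vertices (\<open>measure_omit_vertex\<close>, \<open>volume_le_det\<close>).  As the vertices are
  unit vectors, the rows of \<open>N\<close> have known lengths, and Hadamard's inequality yields
  \<open>d! * vol P \<le> F s * F t\<close> with \<open>F x = (x + 1) powr ((x + 1) / 2) / x powr (x / 2)\<close>,
  the \<open>simplex_factor\<close> below.
  Equality forces the rows to be orthogonal, that is, \<open>p i \<bullet> p j\<close> is \<open>- 1 / s\<close> within
  \<open>A\<close>, \<open>- 1 / t\<close> within its complement and \<open>0\<close> between the two: the vertices
  are those of two regular simplices in orthogonal subspaces
  (\<open>inscribed_polytope_volume_bound\<close>, \<open>balanced_configuration_decomposition\<close>).

  The function \<open>F\<close> is strictly log-concave, so \<open>F s * F t\<close> is largest exactly for the
  balanced splitting of \<open>d\<close> (\<open>simplex_factor_product_le\<close>).  Finally such a pair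
  of simplices exists (\<open>exists_balanced_configuration\<close>), and for it the covering simplices
  have disjoint interiors, so the bound is attained (\<open>volume_balanced_configuration\<close>).
\<close>

section \<open>Volumes of linear images and of simplices\<close>

text \<open>It suffices to treat boxes, and a translation moves the lower corner of a box to the origin, where
  \<open>measure_shear_interval\<close> applies.\<close>

lemma measure_lebesgue_shear:
  fixes S :: "(real ^ 'n) set" and p q :: 'n
  assumes "p \<noteq> q" and S: "S \<in> lmeasurable"
  defines "h \<equiv> \<lambda>x :: real ^ 'n. \<chi> i. if i = p then x $ p + x $ q else x $ i"
  shows "h ` S \<in> lmeasurable \<and> measure lebesgue S = measure lebesgue (h ` S)"
proof -
  have lin: "linear h"
    unfolding h_def by (rule linearI) (auto simp: vec_eq_iff algebra_simps)
  have box: "measure lebesgue (h ` cbox a b) = 1 * measure lebesgue (cbox a b)" for a b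
  proof (cases "cbox a b = {}")
    case False
    have "cbox a b = (+) a ` cbox 0 (b - a)"
      by (simp flip: cbox_translation)
    then have "h ` cbox a b = (+) (h a) ` h ` cbox 0 (b - a)"
      using linear_add[OF lin] by (simp add: image_image)
    then have "measure lebesgue (h ` cbox a b) = measure lebesgue (h ` cbox 0 (b - a))"
      by (simp only: measure_translation)
    also have "\<dots> = measure lebesgue (cbox 0 (b - a))"
      unfolding h_def
      by (rule measure_shear_interval)
        (use \<open>p \<noteq> q\<close> False \<open>cbox a b = (+) a ` cbox 0 (b - a)\<close> in auto)
    also have "\<dots> = measure lebesgue ((+) a ` cbox 0 (b - a))"
      by (simp only: measure_translation)
    finally show ?thesis
      using \<open>cbox a b = (+) a ` cbox 0 (b - a)\<close> by simp
  qed simp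
  show ?thesis
    using measure_linear_sufficient[OF lin S box] by simp
qed

lemma measure_lebesgue_swap:
  fixes S :: "(real ^ 'n) set" and p q :: 'n
  assumes S: "S \<in> lmeasurable"
  defines "h \<equiv> \<lambda>x :: real ^ 'n. \<chi> i. x $ Transposition.transpose p q i"
  shows "h ` S \<in> lmeasurable \<and> measure lebesgue S = measure lebesgue (h ` S)"
proof -
  have lin: "linear h"
    unfolding h_def by (rule linearI) (auto simp: vec_eq_iff)
  have hh: "h (h x) = x" for x
    by (simp add: h_def vec_eq_iff)
  have hbox: "h x \<in> cbox (h a) (h b)" if "x \<in> cbox a b" for x a b
    using that by (simp add: h_def mem_box_cart)
  have box: "measure lebesgue (h ` cbox a b) = 1 * measure lebesgue (cbox a b)" for a b
  proof (cases "cbox a b = {}")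
    case False
    have eq: "h ` cbox a b = cbox (h a) (h b)"
    proof
      show "cbox (h a) (h b) \<subseteq> h ` cbox a b"
        using hbox[of _ "h a" "h b"] by (metis hh image_eqI subsetI)
    qed (use hbox in auto)
    moreover have "cbox (h a) (h b) \<noteq> {}"
      using False eq by blast
    ultimately show ?thesis
      using False prod.permute[OF permutes_swap_id[of p UNIV q], of "\<lambda>i. b $ i - a $ i"]
      by (simp add: content_cbox_cart h_def o_def)
  qed simp
  show ?thesis
    using measure_linear_sufficient[OF lin S box] by simp
qed

text \<open>Every linear map is a composition of singular maps, coordinate scalings, swaps and shears; the
  formula is stable under composition and holds for each of these.\<close>

proposition measure_lebesgue_linear_image:
  fixes f :: "real ^ 'n \<Rightarrow> real ^ 'n"
  assumes "linear f" and "S \<in> lmeasurable"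
  shows "measure lebesgue (f ` S) = \<bar>det (matrix f)\<bar> * measure lebesgue S"
proof -
  have "\<forall>S \<in> lmeasurable. f ` S \<in> lmeasurable
          \<and> measure lebesgue (f ` S) = \<bar>det (matrix f)\<bar> * measure lebesgue S"
    using \<open>linear f\<close>
  proof (rule induct_linear_elementary; intro ballI)
    fix f g :: "real ^ 'n \<Rightarrow> real ^ 'n" and S :: "(real ^ 'n) set"
    assume "linear f" "linear g"
      and f: "\<forall>S \<in> lmeasurable. f ` S \<in> lmeasurable
          \<and> measure lebesgue (f ` S) = \<bar>det (matrix f)\<bar> * measure lebesgue S"
      and g: "\<forall>S \<in> lmeasurable. g ` S \<in> lmeasurable
          \<and> measure lebesgue (g ` S) = \<bar>det (matrix g)\<bar> * measure lebesgue S"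
      and S: "S \<in> lmeasurable"
    then have "f ` g ` S \<in> lmeasurable"
      "measure lebesgue (f ` g ` S) = \<bar>det (matrix f)\<bar> * (\<bar>det (matrix g)\<bar> * measure lebesgue S)"
      by auto
    then show "(f \<circ> g) ` S \<in> lmeasurable
        \<and> measure lebesgue ((f \<circ> g) ` S) = \<bar>det (matrix (f \<circ> g))\<bar> * measure lebesgue S"
      by (simp add: matrix_compose[OF \<open>linear g\<close> \<open>linear f\<close>] det_mul abs_mult image_comp)
  next
    fix f :: "real ^ 'n \<Rightarrow> real ^ 'n" and i and S :: "(real ^ 'n) set"
    assume lin: "linear f" and 0: "\<And>x. f x $ i = 0" and "S \<in> lmeasurable"
    have "axis i 1 \<noteq> f x" for x
      using 0[of x] by (metis axis_nth zero_neq_one)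
    then have "\<not> surj f"
      by blast
    then have "\<not> inj f"
      using linear_injective_imp_surjective[OF lin] by blast
    then have "negligible (f ` S)" "det (matrix f) = 0"
      using negligible_linear_singular_image[OF lin] det_nz_iff_inj[OF lin] by auto
    then show "f ` S \<in> lmeasurable
        \<and> measure lebesgue (f ` S) = \<bar>det (matrix f)\<bar> * measure lebesgue S"
      by (simp add: negligible_imp_measure0 negligible_imp_measurable)
  next
    fix c :: "'n \<Rightarrow> real" and S :: "(real ^ 'n) set"
    assume S: "S \<in> lmeasurable"
    have "det (matrix (\<lambda>x :: real ^ 'n. \<chi> i. c i * x $ i)) = prod c UNIV"
      by (simp add: matrix_def axis_def det_diagonal)
    then show "(\<lambda>x. \<chi> i. c i * x $ i) ` S \<in> lmeasurable \<and>
        measure lebesgue ((\<lambda>x. \<chi> i. c i * x $ i) ` S)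
          = \<bar>det (matrix (\<lambda>x. \<chi> i. c i * x $ i))\<bar> * measure lebesgue S"
      using measurable_stretch[OF S, of c] measure_stretch[OF S, of c] by simp
  next
    fix p q :: 'n and S :: "(real ^ 'n) set"
    assume "p \<noteq> q" and S: "S \<in> lmeasurable"
    have "matrix (\<lambda>x :: real ^ 'n. \<chi> i. x $ Transposition.transpose p q i)
        = (\<chi> i. mat 1 $ Transposition.transpose p q i)"
      by (simp add: matrix_def axis_def mat_def vec_eq_iff)
    then have "\<bar>det (matrix (\<lambda>x :: real ^ 'n. \<chi> i. x $ Transposition.transpose p q i))\<bar> = 1"
      using det_permute_rows[OF permutes_swap_id[of p UNIV q], of "mat 1 :: real ^ 'n ^ 'n"]
      by (simp add: sign_swap_id)
    then show "(\<lambda>x. \<chi> i. x $ Transposition.transpose p q i) ` S \<in> lmeasurable \<and>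
        measure lebesgue ((\<lambda>x. \<chi> i. x $ Transposition.transpose p q i) ` S)
          = \<bar>det (matrix (\<lambda>x. \<chi> i. x $ Transposition.transpose p q i))\<bar> * measure lebesgue S"
      using measure_lebesgue_swap[OF S, of p q] by simp
  next
    fix p q :: 'n and S :: "(real ^ 'n) set"
    assume "p \<noteq> q" and S: "S \<in> lmeasurable"
    have "matrix (\<lambda>x :: real ^ 'n. \<chi> i. if i = p then x $ p + x $ q else x $ i)
        = (\<chi> k. if k = p then row p (mat 1) + 1 *s row q (mat 1) else row k (mat 1))"
      by (simp add: matrix_def axis_def mat_def row_def vec_eq_iff)
    then have "det (matrix (\<lambda>x :: real ^ 'n. \<chi> i. if i = p then x $ p + x $ q else x $ i)) = 1"
      by (simp only: det_row_operation[OF \<open>p \<noteq> q\<close>] det_I)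
    then show "(\<lambda>x. \<chi> i. if i = p then x $ p + x $ q else x $ i) ` S \<in> lmeasurable \<and>
        measure lebesgue ((\<lambda>x. \<chi> i. if i = p then x $ p + x $ q else x $ i) ` S)
          = \<bar>det (matrix (\<lambda>x. \<chi> i. if i = p then x $ p + x $ q else x $ i))\<bar> * measure lebesgue S"
      using measure_lebesgue_shear[OF \<open>p \<noteq> q\<close> S] by simp
  qed
  with \<open>S \<in> lmeasurable\<close> show ?thesis
    by blast
qed

lemma lmeasurable_convex_hull_finite:
  fixes S :: "'a::euclidean_space set"
  shows "finite S \<Longrightarrow> convex hull S \<in> lmeasurable"
  by (simp add: finite_imp_compact_convex_hull lmeasurable_compact)

text \<open>The simplex is an affine image of the standard simplex, whose volume is the reciprocal of the
  factorial of the dimension.\<close>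

lemma measure_simplex:
  fixes f :: "'n \<Rightarrow> real ^ 'n" and x0 :: "real ^ 'n"
  shows "measure lebesgue (convex hull (insert x0 (range f)))
       = \<bar>det (\<chi> i. f i - x0)\<bar> / fact CARD('n)"
proof -
  define M :: "real ^ 'n ^ 'n" where "M = transpose (\<chi> i. f i - x0)"
  have M: "M *v axis i 1 = f i - x0" for i
    by (simp add: M_def matrix_vector_mult_basis column_def transpose_def vec_eq_iff)
  have Basis: "(Basis :: (real ^ 'n) set) = range (\<lambda>i. axis i 1)"
    by (auto simp: Basis_vec_def)
  have "insert x0 (range f) = (+) x0 ` ((*v) M ` insert 0 Basis)"
    by (simp add: Basis image_image M image_insert del: image_add_0)
  then have "convex hull (insert x0 (range f)) = (+) x0 ` ((*v) M ` (convex hull (insert 0 Basis)))"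
    by (simp only: convex_hull_translation convex_hull_linear_image[OF matrix_vector_mul_linear])
  then have "measure lebesgue (convex hull (insert x0 (range f)))
      = measure lebesgue ((*v) M ` (convex hull (insert 0 Basis)))"
    by (simp only: measure_translation)
  also have "\<dots> = \<bar>det M\<bar> * measure lebesgue (convex hull (insert 0 Basis) :: (real ^ 'n) set)"
    by (simp add: measure_lebesgue_linear_image lmeasurable_convex_hull_finite)
  also have "measure lebesgue (convex hull (insert 0 Basis) :: (real ^ 'n) set) = 1 / fact CARD('n)"
    using content_std_simplex[where 'a = "real ^ 'n"] finite_imp_compact_convex_hull[of "insert 0 Basis :: (real ^ 'n) set"]
    by (simp add: measure_completion compact_imp_closed borel_closed)
  finally show ?thesis
    by (simp add: M_def det_transpose)
qed

section \<open>Determinants with unit rows\<close>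

lemma bij_betw_map_permutation:
  fixes g :: "'a \<Rightarrow> 'b"
  assumes "inj g"
  shows "bij_betw (map_permutation UNIV g) {\<pi>. \<pi> permutes UNIV} {\<pi>. \<pi> permutes range g}"
proof (rule bij_betw_byWitness[where f' = "map_permutation (range g) (inv g)"])
  have b: "bij_betw g UNIV (range g)" "bij_betw (inv g) (range g) UNIV"
    using assms by (simp_all add: inj_imp_bij_betw_inv bij_betw_imageI)
  show "map_permutation UNIV g ` {\<pi>. \<pi> permutes UNIV} \<subseteq> {\<pi>. \<pi> permutes range g}"
    "map_permutation (range g) (inv g) ` {\<pi>. \<pi> permutes range g} \<subseteq> {\<pi>. \<pi> permutes UNIV}"
    using map_permutation_permutes[OF b(1)] map_permutation_permutes[OF b(2)] by auto
  show "\<forall>\<pi>\<in>{\<pi>. \<pi> permutes UNIV}. map_permutation (range g) (inv g) (map_permutation UNIV g \<pi>) = \<pi>"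
    using b(1) assms by (auto intro!: map_permutation_compose_inv)
  show "\<forall>\<pi>\<in>{\<pi>. \<pi> permutes range g}. map_permutation UNIV g (map_permutation (range g) (inv g) \<pi>) = \<pi>"
    using b(2) by (auto intro!: map_permutation_compose_inv simp: f_inv_into_f)
qed

text \<open>In the Leibniz formula only the permutations that fix every index of a unit row survive, and
  these are the permutations of the remaining indices.  This is how determinants over index
  types of different sizes are compared below.\<close>

lemma det_unit_rows:
  fixes M :: "'c::comm_ring_1 ^ 'b ^ 'b" and g :: "'a::finite \<Rightarrow> 'b::finite"
  assumes "inj g" and unit: "\<And>r. r \<notin> range g \<Longrightarrow> M $ r = axis r 1"
  shows "det M = det (\<chi> i j. M $ g i $ g j)"
proof -
  have off: "(\<Prod>r\<in>UNIV. M $ r $ \<pi> r) = (\<Prod>i\<in>UNIV. M $ g i $ \<pi> (g i))"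
    if "\<pi> permutes range g" for \<pi>
  proof -
    have "(\<Prod>r\<in>UNIV. M $ r $ \<pi> r) = (\<Prod>r\<in>range g. M $ r $ \<pi> r)"
      using permutes_not_in[OF that] unit by (intro prod.mono_neutral_right) auto
    also have "\<dots> = (\<Prod>i\<in>UNIV. M $ g i $ \<pi> (g i))"
      using \<open>inj g\<close> by (simp add: prod.reindex)
    finally show ?thesis .
  qed
  have zero: "(\<Prod>r\<in>UNIV. M $ r $ \<pi> r) = 0"
    if "\<pi> permutes UNIV" "\<not> \<pi> permutes range g" for \<pi>
  proof -
    have "\<exists>r. r \<notin> range g \<and> \<pi> r \<noteq> r"
      using that permutes_superset[OF that(1), of "range g"] by auto
    then obtain r where "r \<notin> range g" "\<pi> r \<noteq> r"
      by blast
    then have "M $ r $ \<pi> r = 0"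
      by (simp add: unit axis_def)
    then show ?thesis
      by (intro prod_zero) auto
  qed
  have "det M = (\<Sum>\<pi> | \<pi> permutes range g. of_int (sign \<pi>) * (\<Prod>r\<in>UNIV. M $ r $ \<pi> r))"
    unfolding det_def
    by (rule sum.mono_neutral_right) (auto simp: zero intro: permutes_subset finite_permutations)
  also have "\<dots> = (\<Sum>\<pi> | \<pi> permutes range g. of_int (sign \<pi>) * (\<Prod>i\<in>UNIV. M $ g i $ \<pi> (g i)))"
    by (simp add: off)
  also have "\<dots> = (\<Sum>\<pi> | \<pi> permutes UNIV. of_int (sign (map_permutation UNIV g \<pi>))
                      * (\<Prod>i\<in>UNIV. M $ g i $ map_permutation UNIV g \<pi> (g i)))"
    by (rule sum.reindex_bij_betw[OF bij_betw_map_permutation[OF \<open>inj g\<close>], symmetric])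
  also have "\<dots> = det (\<chi> i j. M $ g i $ g j)"
    unfolding det_def
    using \<open>inj g\<close> by (intro sum.cong) (simp_all add: sign_map_permutation map_permutation_apply)
  finally show ?thesis .
qed

section \<open>Hadamard's inequality\<close>

lemma det_subtract_row:
  fixes A :: "real ^ 'n ^ 'n"
  assumes "i \<noteq> j"
  shows "det (\<chi> k. if k = i then A $ i - c *\<^sub>R A $ j else A $ k) = det A"
proof -
  have "(\<chi> k. if k = i then A $ i - c *\<^sub>R A $ j else A $ k)
      = (\<chi> k. if k = i then row i A + (- c) *s row j A else row k A)"
    by (auto simp: row_def vec_eq_iff)
  then show ?thesis
    using det_row_operation[OF assms, of A "- c"] by simp
qed

lemma det_row_scale:
  fixes A :: "real ^ 'n ^ 'n"
  shows "det (\<chi> k. c k *\<^sub>R A $ k) = prod c UNIV * det A"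
  using det_rows_mul[of c "\<lambda>k. A $ k"] by (simp add: scalar_mult_eq_scaleR)

lemma det_orthogonal_rows:
  fixes A :: "real ^ 'n ^ 'n"
  assumes "\<And>i j. i \<noteq> j \<Longrightarrow> A $ i \<bullet> A $ j = 0"
  shows "\<bar>det A\<bar> = (\<Prod>i\<in>UNIV. norm (A $ i))"
proof -
  have "(det A)\<^sup>2 = det (A ** transpose A)"
    by (simp add: det_mul det_transpose power2_eq_square)
  also have "A ** transpose A = (\<chi> i j. A $ i \<bullet> A $ j)"
    by (simp add: matrix_matrix_mult_def transpose_def inner_vec_def vec_eq_iff)
  also have "det \<dots> = (\<Prod>i\<in>UNIV. (norm (A $ i))\<^sup>2)"
    using assms by (subst det_diagonal) (simp_all add: power2_norm_eq_inner)
  also have "\<dots> = (\<Prod>i\<in>UNIV. norm (A $ i))\<^sup>2"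
    by (simp add: prod_power_distrib)
  finally have "(\<bar>det A\<bar>)\<^sup>2 = (\<Prod>i\<in>UNIV. norm (A $ i))\<^sup>2"
    by simp
  then show ?thesis
    by (rule power2_eq_imp_eq) (simp_all add: prod_nonneg)
qed

lemma norm_subtract_projection_less:
  fixes x y :: "'a::real_inner"
  assumes "x \<bullet> y \<noteq> 0"
  shows "norm (x - ((x \<bullet> y) / (y \<bullet> y)) *\<^sub>R y) < norm x"
proof -
  define c where "c = (x \<bullet> y) / (y \<bullet> y)"
  have y: "y \<bullet> y > 0"
    using assms by (cases "y = 0") auto
  have "(norm (x - c *\<^sub>R y))\<^sup>2 = (norm x)\<^sup>2 - (x \<bullet> y)\<^sup>2 / (y \<bullet> y)"
    using y by (simp only: power2_norm_eq_inner)
      (simp add: c_def inner_diff_left inner_diff_right inner_commute power2_eq_square field_simps)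
  also have "\<dots> < (norm x)\<^sup>2"
    using assms y by simp
  finally show ?thesis
    unfolding c_def by (rule power_less_imp_less_base) simp
qed

text \<open>Subtracting from one row its projection on another one preserves the determinant and shortens
  the row; normalizing the shortened row then enlarges the determinant.\<close>

lemma det_improve_unit_rows:
  fixes A :: "real ^ 'n ^ 'n"
  assumes unit: "\<And>k. norm (A $ k) = 1" and ij: "i \<noteq> j" "A $ i \<bullet> A $ j \<noteq> 0" and "det A \<noteq> 0"
  shows "\<exists>B :: real ^ 'n ^ 'n. (\<forall>k. norm (B $ k) = 1) \<and> \<bar>det A\<bar> < \<bar>det B\<bar>"
proof -
  define v where "v = A $ i - ((A $ i \<bullet> A $ j) / (A $ j \<bullet> A $ j)) *\<^sub>R A $ j"
  define C where "C = (\<chi> k. if k = i then v else A $ k)"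
  have C: "det C = det A"
    using det_subtract_row[OF ij(1), of A "(A $ i \<bullet> A $ j) / (A $ j \<bullet> A $ j)"]
    unfolding C_def v_def .
  have "norm v < 1"
    using norm_subtract_projection_less[OF ij(2)] unit[of i] by (simp add: v_def)
  have "v \<noteq> 0"
  proof
    assume "v = 0"
    then have "det C = 0"
      by (intro det_zero_row(2)[of i]) (simp add: C_def row_def vec_eq_iff)
    then show False
      using C \<open>det A \<noteq> 0\<close> by simp
  qed
  define B where "B = (\<chi> k. (if k = i then 1 / norm v else 1) *\<^sub>R C $ k)"
  have "\<forall>k. norm (B $ k) = 1"
    using unit \<open>v \<noteq> 0\<close> by (simp add: B_def C_def)
  moreover have "det B = det A / norm v"
    by (simp add: B_def det_row_scale C prod.delta)
  then have "\<bar>det A\<bar> < \<bar>det B\<bar>"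
    using \<open>norm v < 1\<close> \<open>v \<noteq> 0\<close> \<open>det A \<noteq> 0\<close> by (simp add: abs_divide less_divide_eq)
  ultimately show ?thesis
    by blast
qed

text \<open>The determinant attains its maximum over the compact set of matrices with unit rows.  By the
  improvement step a nonsingular maximizer has orthogonal rows, so its determinant is
  \<open>1\<close> up to sign.\<close>

lemma hadamard_inequality_unit:
  fixes A :: "real ^ 'n ^ 'n"
  assumes unit: "\<And>k. norm (A $ k) = 1"
  shows "\<bar>det A\<bar> \<le> 1"
proof -
  define U where "U = {B :: real ^ 'n ^ 'n. \<forall>k. norm (B $ k) = 1}"
  have "closed U"
    unfolding U_def by (intro closed_Collect_all closed_Collect_eq continuous_intros)
  moreover have "bounded U"
  proof -
    have "norm B \<le> real CARD('n)" if "B \<in> U" for B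
    proof -
      have "norm B \<le> (\<Sum>k\<in>UNIV. norm (B $ k))"
        unfolding norm_vec_def[of B] by (rule L2_set_le_sum) simp
      then show ?thesis
        using that by (simp add: U_def)
    qed
    then show ?thesis
      by (auto simp: bounded_iff)
  qed
  ultimately have "compact U"
    by (simp add: compact_eq_bounded_closed)
  moreover have "continuous_on U (\<lambda>B. \<bar>det B\<bar>)"
    unfolding det_def by (intro continuous_intros)
  moreover have "A \<in> U"
    using unit by (simp add: U_def)
  ultimately obtain M where M: "M \<in> U" "\<And>B. B \<in> U \<Longrightarrow> \<bar>det B\<bar> \<le> \<bar>det M\<bar>"
    by (metis continuous_attains_sup emptyE)
  have "\<bar>det M\<bar> \<le> 1"
  proof (cases "det M = 0")
    case False
    have "M $ i \<bullet> M $ j = 0" if "i \<noteq> j" for i j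
      using det_improve_unit_rows[OF _ that, of M] False M by (force simp: U_def)
    then show ?thesis
      using M(1) by (simp add: det_orthogonal_rows U_def)
  qed simp
  then show ?thesis
    using M(2)[OF \<open>A \<in> U\<close>] by simp
qed

theorem hadamard_inequality:
  fixes A :: "real ^ 'n ^ 'n"
  shows "\<bar>det A\<bar> \<le> (\<Prod>i\<in>UNIV. norm (A $ i))"
proof (cases "\<exists>i. A $ i = 0")
  case True
  then obtain i where "row i A = 0"
    by (auto simp: row_def vec_eq_iff)
  then show ?thesis
    by (simp add: det_zero_row(2) prod_nonneg)
next
  case False
  define B where "B = (\<chi> i. (1 / norm (A $ i)) *\<^sub>R A $ i)"
  have "\<bar>det B\<bar> \<le> 1"
    using False by (intro hadamard_inequality_unit) (simp add: B_def)
  moreover have "A = (\<chi> i. norm (A $ i) *\<^sub>R B $ i)"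
    using False by (simp add: B_def vec_eq_iff)
  then have "det A = (\<Prod>i\<in>UNIV. norm (A $ i)) * det B"
    using det_row_scale[of "\<lambda>i. norm (A $ i)" B] by simp
  ultimately show ?thesis
    by (simp add: abs_mult prod_nonneg mult_left_le)
qed

text \<open>If two rows were not orthogonal, replacing one of them by its component orthogonal to the other
  would give a matrix with the same determinant and a smaller product of row norms, against
  Hadamard's inequality.\<close>

lemma hadamard_equality_imp_orthogonal:
  fixes A :: "real ^ 'n ^ 'n"
  assumes eq: "\<bar>det A\<bar> = (\<Prod>i\<in>UNIV. norm (A $ i))" and "det A \<noteq> 0" and "i \<noteq> j"
  shows "A $ i \<bullet> A $ j = 0"
proof (rule ccontr)
  assume ne: "A $ i \<bullet> A $ j \<noteq> 0"
  define v where "v = A $ i - ((A $ i \<bullet> A $ j) / (A $ j \<bullet> A $ j)) *\<^sub>R A $ j"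
  define C where "C = (\<chi> k. if k = i then v else A $ k)"
  have C: "det C = det A"
    using det_subtract_row[OF \<open>i \<noteq> j\<close>, of A "(A $ i \<bullet> A $ j) / (A $ j \<bullet> A $ j)"]
    unfolding C_def v_def .
  have pos: "(\<Prod>k\<in>UNIV - {i}. norm (A $ k)) > 0"
  proof (rule prod_pos)
    fix k
    have "(\<Prod>l\<in>UNIV. norm (A $ l)) \<noteq> 0"
      unfolding eq[symmetric] using \<open>det A \<noteq> 0\<close> by simp
    then show "norm (A $ k) > 0"
      by simp
  qed
  have "\<bar>det C\<bar> \<le> norm (C $ i) * (\<Prod>k\<in>UNIV - {i}. norm (C $ k))"
    using hadamard_inequality[of C] by (simp add: prod.remove[of UNIV i])
  also have "\<dots> = norm v * (\<Prod>k\<in>UNIV - {i}. norm (A $ k))"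
    by (auto simp: C_def intro!: prod.cong)
  also have "\<dots> < norm (A $ i) * (\<Prod>k\<in>UNIV - {i}. norm (A $ k))"
    using norm_subtract_projection_less[OF ne] pos by (simp add: v_def)
  also have "\<dots> = \<bar>det A\<bar>"
    by (simp add: eq prod.remove[of UNIV i])
  finally show False
    using C by simp
qed

section \<open>Lifted point configurations\<close>

text \<open>A point of \<open>\<real>\<^sup>d\<close> receives two further coordinates, which record the class of
  the point in a bipartition of a family of \<open>d + 2\<close> points.  The index type
  \<open>'n + 2\<close> serves both for these points and for the coordinates of the lifted space, so
  that the lifted points are the rows of a square matrix.\<close>

definition lift :: "real ^ 'n \<Rightarrow> real \<Rightarrow> real \<Rightarrow> real ^ ('n + 2)" where
  "lift x s t = (\<chi> c. case c of Inl k \<Rightarrow> x $ k | Inr e \<Rightarrow> if e = 1 then s else t)"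

lemma lift_nth [simp]:
  "lift x s t $ Inl k = x $ k" "lift x s t $ Inr 1 = s" "lift x s t $ Inr 2 = t"
  by (simp_all add: lift_def)

lemma sum_UNIV_plus_2: "(\<Sum>c\<in>UNIV. f c) = (\<Sum>k\<in>UNIV. f (Inl k)) + f (Inr 1) + f (Inr 2)"
  for f :: "'n::finite + 2 \<Rightarrow> 'b::comm_monoid_add"
  by (simp add: UNIV_sum sum.union_disjoint sum.reindex UNIV_2 add_ac image_iff disjoint_iff)

lemma vec_eq_iff_plus_2:
  fixes x y :: "'b ^ ('n::finite + 2)"
  shows "x = y \<longleftrightarrow> (\<forall>k. x $ Inl k = y $ Inl k) \<and> x $ Inr 1 = y $ Inr 1 \<and> x $ Inr 2 = y $ Inr 2"
proof -
  have "(\<forall>c. x $ c = y $ c) \<longleftrightarrow> (\<forall>k. x $ Inl k = y $ Inl k) \<and> (\<forall>e. x $ Inr e = y $ Inr e)"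
    by (rule split_sum_all)
  then show ?thesis
    by (simp only: vec_eq_iff forall_2)
qed

lemma inner_lift: "lift x s t \<bullet> lift x' s' t' = x \<bullet> x' + s * s' + t * t'"
  by (simp add: inner_vec_def sum_UNIV_plus_2)

lemma lift_add: "lift x s t + lift x' s' t' = lift (x + x') (s + s') (t + t')"
  and lift_scaleR: "c *\<^sub>R lift x s t = lift (c *\<^sub>R x) (c * s) (c * t)"
  by (simp_all add: vec_eq_iff_plus_2)

lemma lift_sum: "(\<Sum>i\<in>I. lift (x i) (s i) (t i)) = lift (sum x I) (sum s I) (sum t I)"
proof (induction I rule: infinite_finite_induct)
  have "0 = lift 0 0 0"
    by (simp add: vec_eq_iff_plus_2)
  then show "(\<Sum>i\<in>I. lift (x i) (s i) (t i)) = lift (sum x I) (sum s I) (sum t I)"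
    if "infinite I" for I
    using that by simp
  show "(\<Sum>i\<in>{}. lift (x i) (s i) (t i)) = lift (sum x {}) (sum s {}) (sum t {})"
    using \<open>0 = lift 0 0 0\<close> by simp
qed (simp add: lift_add)

text \<open>The weights \<open>\<alpha>\<close> and \<open>\<beta>\<close> of the two classes are free parameters: the
  volume formula holds for all of them, and the final estimate comes from one choice.\<close>

definition lifted_rows ::
    "('n + 2 \<Rightarrow> real ^ 'n) \<Rightarrow> ('n + 2) set \<Rightarrow> real \<Rightarrow> real \<Rightarrow> real ^ ('n + 2) ^ ('n + 2)" where
  "lifted_rows p A \<alpha> \<beta> =
     (\<chi> l. lift (p l) (if l \<in> A then \<alpha> else 0) (if l \<in> A then 0 else \<beta>))"

text \<open>If one lifted point is replaced by the vector \<open>(0, \<alpha>, -\<beta>)\<close>, the determinant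
  measures the simplex spanned by the other points: the condition on the marks says that all
  \<open>(s, t)\<close> lie on the line through \<open>(\<alpha>, 0)\<close> and
  \<open>(0, \<beta>)\<close>, so that two rows suffice to clear the marks in all others, leaving the edge vectors \<open>x k - y\<close>.\<close>

lemma det_marked_simplex:
  fixes x :: "'n::finite \<Rightarrow> real ^ 'n" and y :: "real ^ 'n"
  assumes lin: "\<And>k. s k * \<beta> + t k * \<alpha> = \<alpha> * \<beta>" "s' * \<beta> + t' * \<alpha> = \<alpha> * \<beta>"
    and "\<alpha> \<noteq> 0"
  shows "det (\<chi> l. case l of Inl k \<Rightarrow> lift (x k) (s k) (t k)
                     | Inr e \<Rightarrow> if e = 1 then lift 0 \<alpha> (- \<beta>) else lift y s' t')
       = \<alpha> * \<beta> * det (\<chi> k. x k - y)"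
    (is "det ?R = _")
proof -
  \<comment> \<open>\<open>B\<close> records the edge vectors and how the two distinguished rows, collected in
    \<open>T\<close>, have to be added to recover the given rows.\<close>
  define B :: "real ^ ('n + 2) ^ ('n + 2)" where
    "B = (\<chi> l. case l of Inl k \<Rightarrow> lift (x k - y) ((s k - s') / \<alpha>) 1 | Inr e \<Rightarrow> axis (Inr e) 1)"
  define T :: "real ^ ('n + 2) ^ ('n + 2)" where
    "T = (\<chi> l. case l of Inl k \<Rightarrow> axis (Inl k) 1
                 | Inr e \<Rightarrow> if e = 1 then lift 0 \<alpha> (- \<beta>) else lift y s' t')"
  have row: "(B ** T) $ l = (\<Sum>j\<in>UNIV. B $ l $ j *\<^sub>R T $ j)" for l
    by (simp add: matrix_matrix_mult_def vec_eq_iff)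
  have basis: "(\<Sum>k\<in>UNIV. v $ k *\<^sub>R axis (Inl k) 1) = lift v 0 0" for v :: "real ^ 'n"
    by (simp add: vec_eq_iff_plus_2 axis_def if_distrib[of "\<lambda>z. _ * z"] cong: if_cong)
  have "?R $ Inl k = (B ** T) $ Inl k" for k
  proof -
    have *: "t' = (\<alpha> * \<beta> - s' * \<beta>) / \<alpha>" "t k = (\<alpha> * \<beta> - s k * \<beta>) / \<alpha>"
      using lin(2) lin(1)[of k] \<open>\<alpha> \<noteq> 0\<close> by (simp_all add: field_simps)
    have "(B ** T) $ Inl k
        = lift (x k - y) 0 0 + ((s k - s') / \<alpha>) *\<^sub>R lift 0 \<alpha> (- \<beta>) + 1 *\<^sub>R lift y s' t'"
      unfolding row sum_UNIV_plus_2 by (simp add: B_def T_def basis del: vector_minus_component)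
    also have "\<dots> = lift (x k) (s k) (t k)"
      unfolding lift_scaleR lift_add * using \<open>\<alpha> \<noteq> 0\<close> by (simp add: field_simps)
    finally show ?thesis
      by simp
  qed
  moreover have "?R $ Inr e = (B ** T) $ Inr e" for e
    unfolding row by (simp add: B_def T_def axis_def if_distrib[of "\<lambda>z. z *\<^sub>R _"] cong: if_cong)
  ultimately have "?R = B ** T"
    by (simp only: vec_eq_iff[of ?R] split_sum_all) auto
  then have "det ?R = det B * det T"
    by (simp only: det_mul)
  also have "det B = det (\<chi> i j. B $ Inl i $ Inl j :: real ^ 'n ^ 'n)"
    by (rule det_unit_rows) (auto simp: B_def split: sum.splits)
  also have "(\<chi> i j. B $ Inl i $ Inl j :: real ^ 'n ^ 'n) = (\<chi> k. x k - y)"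
    by (simp add: B_def vec_eq_iff)
  also have "det T = det (\<chi> i j. T $ Inr i $ Inr j :: real ^ 2 ^ 2)"
    by (rule det_unit_rows) (auto simp: T_def split: sum.splits)
  also have "\<dots> = \<alpha> * \<beta>"
    using lin(2) by (simp add: det_2 T_def algebra_simps)
  finally show ?thesis
    by simp
qed

lemma permutation_two_values:
  assumes "a \<noteq> b" "i \<noteq> j"
  obtains \<pi> where "\<pi> permutes UNIV" "\<pi> a = i" "\<pi> b = j"
proof
  let ?\<tau> = "Transposition.transpose a i"
  let ?\<pi> = "?\<tau> \<circ> Transposition.transpose b (?\<tau> j)"
  show "?\<pi> permutes UNIV"
    by (intro permutes_compose permutes_swap_id UNIV_I)
  have "?\<tau> j \<noteq> a"
    using \<open>i \<noteq> j\<close> by (metis transpose_apply_first transpose_involutory)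
  then show "?\<pi> a = i"
    using \<open>a \<noteq> b\<close> by (simp add: Transposition.transpose_def[of b])
  show "?\<pi> b = j"
    by simp
qed

lemma cramer_row:
  fixes N :: "real ^ 'm ^ 'm"
  shows "det (\<chi> l. if l = i then (\<Sum>k\<in>UNIV. c k *\<^sub>R N $ k) else N $ l) = c i * det N"
  using cramer_lemma_transpose[of i "\<chi> k. c k" N]
  by (simp add: row_def scalar_mult_eq_scaleR cong: if_cong)

text \<open>The affine dependence, summed over the lifted rows, gives \<open>\<Lambda>\<close> times
  \<open>(0, \<alpha>, -\<beta>)\<close>.  Cramer's rule therefore says that replacing row
  \<open>i\<close> by this vector multiplies the determinant by \<open>c i / \<Lambda>\<close>, and
  the new determinant measures the simplex without vertex \<open>i\<close>.  Hence the volumes of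
  the simplices that omit one point of \<open>A\<close> are the shares \<open>\<bar>c i\<bar> / \<Lambda>\<close>
  of one common quantity.\<close>

lemma measure_omit_vertex:
  fixes p :: "'n::finite + 2 \<Rightarrow> real ^ 'n"
  assumes dep: "(\<Sum>l\<in>UNIV. c l *\<^sub>R p l) = 0" "sum c A = \<Lambda>" "sum c (- A) = - \<Lambda>"
    and pos: "\<Lambda> > 0" "\<alpha> > 0" "\<beta> > 0"
  shows "measure lebesgue (convex hull (p ` (UNIV - {i})))
       = \<bar>c i\<bar> / \<Lambda> * (\<bar>det (lifted_rows p A \<alpha> \<beta>)\<bar> / (\<alpha> * \<beta> * fact CARD('n)))"
proof -
  define N where "N = lifted_rows p A \<alpha> \<beta>"
  define s t where "s = (\<lambda>l. if l \<in> A then \<alpha> else 0)" and "t = (\<lambda>l. if l \<in> A then 0 else \<beta>)"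
  have N: "N $ l = lift (p l) (s l) (t l)" for l
    by (simp add: N_def lifted_rows_def s_def t_def)
  define N' where "N' = (\<chi> l. if l = i then lift 0 \<alpha> (- \<beta>) else N $ l)"
  have "(\<Sum>l\<in>UNIV. c l * s l) = (\<Sum>l\<in>A. c l * \<alpha>)" "(\<Sum>l\<in>UNIV. c l * t l) = (\<Sum>l\<in>-A. c l * \<beta>)"
    by (auto simp: s_def t_def intro!: sum.mono_neutral_cong_right)
  then have "(\<Sum>l\<in>UNIV. c l *\<^sub>R N $ l) = lift 0 (\<Lambda> * \<alpha>) (- \<Lambda> * \<beta>)"
    by (simp add: N lift_scaleR lift_sum dep flip: sum_distrib_right)
  also have "\<dots> = \<Lambda> *\<^sub>R lift 0 \<alpha> (- \<beta>)"
    by (simp add: lift_scaleR)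
  finally have "c i * det N = det (\<chi> l. if l = i then \<Lambda> *\<^sub>R lift 0 \<alpha> (- \<beta>) else N $ l)"
    using cramer_row[of i c N] by (simp cong: if_cong)
  also have "(\<chi> l. if l = i then \<Lambda> *\<^sub>R lift 0 \<alpha> (- \<beta>) else N $ l)
      = (\<chi> l. (if l = i then \<Lambda> else 1) *\<^sub>R N' $ l)"
    by (simp add: N'_def vec_eq_iff)
  finally have detN: "c i * det N = \<Lambda> * det N'"
    by (simp add: det_row_scale prod.delta)
  have "Inr 1 \<noteq> (Inr 2 :: 'n + 2)"
    by simp
  then obtain j where "i \<noteq> j"
    by metis
  \<comment> \<open>Reordering the points makes row \<open>i\<close> and one further row the two distinguished rows.\<close>
  obtain \<pi> where \<pi>: "\<pi> permutes UNIV" "\<pi> (Inr 1) = i" "\<pi> (Inr 2) = j"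
    using permutation_two_values[OF \<open>Inr 1 \<noteq> Inr 2\<close> \<open>i \<noteq> j\<close>] by metis
  have \<pi>_inj: "\<pi> l = \<pi> l' \<longleftrightarrow> l = l'" for l l'
    using permutes_inj[OF \<pi>(1)] by (auto dest: injD)
  have "(\<chi> l. N' $ \<pi> l) = (\<chi> l. case l of
      Inl k \<Rightarrow> lift (p (\<pi> (Inl k))) (s (\<pi> (Inl k))) (t (\<pi> (Inl k)))
    | Inr e \<Rightarrow> if e = 1 then lift 0 \<alpha> (- \<beta>) else lift (p j) (s j) (t j))"
  proof (subst vec_eq_iff, unfold split_sum_all forall_2, intro conjI allI)
    show "(\<chi> l. N' $ \<pi> l) $ Inl k = (\<chi> l. case l of
      Inl k \<Rightarrow> lift (p (\<pi> (Inl k))) (s (\<pi> (Inl k))) (t (\<pi> (Inl k)))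
    | Inr e \<Rightarrow> if e = 1 then lift 0 \<alpha> (- \<beta>) else lift (p j) (s j) (t j)) $ Inl k" for k
      using \<pi>_inj[of "Inl k" "Inr 1"] by (simp add: N'_def N \<pi>)
  qed (use \<open>i \<noteq> j\<close> in \<open>simp_all add: N'_def N \<pi>\<close>)
  then have "det (\<chi> l. N' $ \<pi> l) = \<alpha> * \<beta> * det (\<chi> k. p (\<pi> (Inl k)) - p j)"
    using pos by (simp only:) (rule det_marked_simplex, auto simp: s_def t_def)
  then have "\<bar>det N'\<bar> = \<alpha> * \<beta> * \<bar>det (\<chi> k. p (\<pi> (Inl k)) - p j)\<bar>"
    using pos arg_cong[OF det_permute_rows[OF \<pi>(1), of N'], of abs]
    by (simp add: abs_mult flip: of_int_abs)
  then have det: "\<bar>det (\<chi> k. p (\<pi> (Inl k)) - p j)\<bar> = \<bar>c i\<bar> / \<Lambda> * (\<bar>det N\<bar> / (\<alpha> * \<beta>))"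
    using pos arg_cong[OF detN, of abs] by (simp add: abs_mult field_simps)
  have "UNIV - {i} = \<pi> ` (UNIV - {Inr 1})"
    using permutes_bij[OF \<pi>(1)] \<pi>(2) by (metis bij_def image_set_diff image_insert image_empty)
  also have "UNIV - {Inr 1} = insert (Inr 2) (range (Inl :: 'n \<Rightarrow> 'n + 2))"
    by (auto simp: UNIV_sum UNIV_2)
  finally have "p ` (UNIV - {i}) = insert (p j) (range (\<lambda>k. p (\<pi> (Inl k))))"
    by (simp add: \<pi> image_image)
  then show ?thesis
    by (simp add: measure_simplex det N_def)
qed

section \<open>Covering a polytope by simplices along an affine dependence\<close>

lemma convex_hull_image_finite:
  fixes p :: "'i \<Rightarrow> 'a::real_vector"
  assumes "finite I" "x \<in> convex hull (p ` I)"
  obtains u where "\<And>i. i \<in> I \<Longrightarrow> u i \<ge> 0" "sum u I = 1" "x = (\<Sum>i\<in>I. u i *\<^sub>R p i)"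
proof -
  define C where "C = {\<Sum>i\<in>I. u i *\<^sub>R p i |u. (\<forall>i\<in>I. u i \<ge> 0) \<and> sum u I = 1}"
  have "convex C"
  proof (rule convexI)
    fix x y and a b :: real
    assume "x \<in> C" "y \<in> C" and ab: "0 \<le> a" "0 \<le> b" "a + b = 1"
    then obtain u v where u: "\<forall>i\<in>I. u i \<ge> 0" "sum u I = 1" "x = (\<Sum>i\<in>I. u i *\<^sub>R p i)"
      and v: "\<forall>i\<in>I. v i \<ge> 0" "sum v I = 1" "y = (\<Sum>i\<in>I. v i *\<^sub>R p i)"
      by (auto simp: C_def)
    have "a *\<^sub>R x + b *\<^sub>R y = (\<Sum>i\<in>I. (a * u i + b * v i) *\<^sub>R p i)"
      by (simp add: u v scaleR_sum_right sum.distrib scaleR_left_distrib)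
    moreover have "(\<Sum>i\<in>I. a * u i + b * v i) = 1"
      using u v ab by (simp add: sum.distrib flip: sum_distrib_left)
    moreover have "\<forall>i\<in>I. a * u i + b * v i \<ge> 0"
      using u v ab by simp
    ultimately show "a *\<^sub>R x + b *\<^sub>R y \<in> C"
      unfolding C_def by (intro CollectI exI[of _ "\<lambda>i. a * u i + b * v i"]) auto
  qed
  moreover have "p i \<in> C" if "i \<in> I" for i
    unfolding C_def using that \<open>finite I\<close>
    by (intro CollectI exI[of _ "\<lambda>j. if j = i then 1 else 0"])
      (simp add: if_distrib[of "\<lambda>z. z *\<^sub>R _"] cong: if_cong)
  ultimately have "convex hull (p ` I) \<subseteq> C"
    by (intro hull_minimal) auto
  with assms(2) have "x \<in> C"
    by blast
  then show ?thesis
    using that unfolding C_def by blast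
qed

text \<open>From a convex combination one may subtract a multiple of the dependence until a first
  coefficient vanishes; the point then lies in the simplex without that vertex.  This is the
  argument behind Caratheodory's theorem, with control over the class of the vertex that is
  dropped.\<close>

lemma convex_hull_cover_omit_vertex:
  fixes p :: "'i::finite \<Rightarrow> 'a::real_vector"
  assumes dep: "(\<Sum>l\<in>UNIV. c l *\<^sub>R p l) = 0" "sum c UNIV = 0"
    and nonpos: "\<And>l. l \<notin> A \<Longrightarrow> c l \<le> 0" and ex: "\<exists>l. c l > 0"
  shows "convex hull (range p) \<subseteq> (\<Union>i\<in>A. convex hull (p ` (UNIV - {i})))"
proof
  fix x assume "x \<in> convex hull (range p)"
  then obtain u where u: "\<And>l. u l \<ge> 0" "sum u UNIV = 1" "x = (\<Sum>l\<in>UNIV. u l *\<^sub>R p l)"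
    using convex_hull_image_finite[of UNIV x p] by auto
  define I where "I = {l. c l > 0}"
  have "finite I" "I \<noteq> {}"
    using ex by (auto simp: I_def)
  obtain i where i: "i \<in> I" "\<And>l. l \<in> I \<Longrightarrow> u i / c i \<le> u l / c l"
    using arg_min_least[OF \<open>finite I\<close> \<open>I \<noteq> {}\<close>, of _ "\<lambda>l. u l / c l"]
      arg_min_if_finite(1)[OF \<open>finite I\<close> \<open>I \<noteq> {}\<close>, of "\<lambda>l. u l / c l"] by blast
  \<comment> \<open>The choice of \<open>i\<close> makes \<open>u i / c i\<close> the largest multiple of the dependence that keeps
    all coefficients nonnegative.\<close>
  define w where "w = (\<lambda>l. u l - u i / c i * c l)"
  have w: "w l \<ge> 0" for l
  proof (cases "l \<in> I")
    case True
    then show ?thesis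
      using i(2)[OF True] by (simp add: w_def I_def field_simps)
  next
    case False
    then have "u i / c i * c l \<le> 0"
      using u(1)[of i] i(1) by (intro mult_nonneg_nonpos) (auto simp: I_def)
    then show ?thesis
      using u(1)[of l] by (simp add: w_def)
  qed
  have "sum w UNIV = 1"
    using u(2) dep(2) by (simp add: w_def sum_subtractf flip: sum_distrib_left sum_divide_distrib)
  have "x = (\<Sum>l\<in>UNIV. u l *\<^sub>R p l) - (u i / c i) *\<^sub>R (\<Sum>l\<in>UNIV. c l *\<^sub>R p l)"
    by (simp add: dep u(3))
  also have "\<dots> = (\<Sum>l\<in>UNIV. w l *\<^sub>R p l)"
    by (simp add: w_def scaleR_sum_right sum_subtractf scaleR_left_diff_distrib)
  finally have x: "x = (\<Sum>l\<in>UNIV. w l *\<^sub>R p l)" .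
  have "w i = 0"
    using i(1) by (simp add: w_def I_def)
  have "(\<Sum>l\<in>UNIV - {i}. w l *\<^sub>R p l) \<in> convex hull (p ` (UNIV - {i}))"
  proof (rule convex_sum)
    show "sum w (UNIV - {i}) = 1"
      using \<open>sum w UNIV = 1\<close> \<open>w i = 0\<close> by (simp add: sum.remove[of UNIV i])
  qed (use w in \<open>auto intro: hull_inc\<close>)
  also have "(\<Sum>l\<in>UNIV - {i}. w l *\<^sub>R p l) = x"
    using \<open>w i = 0\<close> by (simp add: x sum.remove[of UNIV i])
  finally show "x \<in> (\<Union>i\<in>A. convex hull (p ` (UNIV - {i})))"
    using i(1) nonpos[of i] by (force simp: I_def)
qed

text \<open>The covering simplices have volumes proportional to \<open>c i\<close> on \<open>A\<close>, so
  their volumes add up to one determinant.\<close>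

lemma volume_le_det:
  fixes p :: "'n::finite + 2 \<Rightarrow> real ^ 'n"
  assumes dep: "(\<Sum>l\<in>UNIV. c l *\<^sub>R p l) = 0" "sum c UNIV = 0"
    and sgn: "\<And>l. l \<in> A \<Longrightarrow> c l \<ge> 0" "\<And>l. l \<notin> A \<Longrightarrow> c l \<le> 0"
    and ex: "\<exists>l. c l > 0" and pos: "\<alpha> > 0" "\<beta> > 0"
  shows "measure lebesgue (convex hull (range p))
       \<le> \<bar>det (lifted_rows p A \<alpha> \<beta>)\<bar> / (\<alpha> * \<beta> * fact CARD('n))"
    (is "_ \<le> ?V")
proof -
  have A: "sum c (- A) = - sum c A"
    using sum.subset_diff[of A UNIV c] dep(2) by (simp add: Compl_eq_Diff_UNIV)
  obtain l where "c l > 0" "l \<in> A"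
    using ex sgn(2) by (metis not_le)
  then have "sum c A > 0"
    using sgn(1) by (intro sum_pos2[of A l]) auto
  have "measure lebesgue (convex hull (range p))
      \<le> measure lebesgue (\<Union>i\<in>A. convex hull (p ` (UNIV - {i})))"
    using convex_hull_cover_omit_vertex[OF dep sgn(2) ex]
    by (intro measure_mono_fmeasurable fmeasurable.finite_UN lmeasurable_convex_hull_finite fmeasurableD) auto
  also have "\<dots> \<le> (\<Sum>i\<in>A. measure lebesgue (convex hull (p ` (UNIV - {i}))))"
    by (intro measure_UNION_le fmeasurableD lmeasurable_convex_hull_finite) auto
  also have "\<dots> = (\<Sum>i\<in>A. c i / sum c A * ?V)"
    using sgn(1)
    by (intro sum.cong) (simp_all add: measure_omit_vertex[OF dep(1) refl A \<open>sum c A > 0\<close> pos])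
  also have "\<dots> = (sum c A / sum c A) * ?V"
    by (simp only: sum_divide_distrib sum_distrib_right)
  finally show ?thesis
    using \<open>sum c A > 0\<close> by simp
qed

text \<open>Lifting with both marks equal to \<open>1\<close> produces two equal coordinates, so the
  lifted points are linearly dependent.\<close>

lemma exists_affine_dependence:
  fixes p :: "'n::finite + 2 \<Rightarrow> real ^ 'n"
  obtains c where "(\<Sum>l\<in>UNIV. c l *\<^sub>R p l) = 0" "sum c UNIV = 0" "\<exists>l. c l \<noteq> 0"
proof -
  define M where "M = (\<chi> r l. lift (p l) 1 1 $ r)"
  have "row (Inr 1) M = row (Inr 2) M"
    by (simp add: M_def row_def)
  then have "det M = 0"
    by (rule det_identical_rows[rotated]) simp
  then obtain x where "x \<noteq> 0" and Mx: "M *v x = 0"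
    using matrix_nonfull_linear_equations_eq[of M] by (auto simp: det_eq_0_rank)
  have "(M *v x) $ Inl k = (\<Sum>l\<in>UNIV. x $ l *\<^sub>R p l) $ k" for k
    by (simp add: M_def matrix_vector_mult_def mult.commute)
  moreover have "(M *v x) $ Inr 1 = (\<Sum>l\<in>UNIV. x $ l)"
    by (simp add: M_def matrix_vector_mult_def)
  ultimately show ?thesis
    using that[of "\<lambda>l. x $ l"] \<open>x \<noteq> 0\<close> Mx by (simp add: vec_eq_iff)
qed

text \<open>If \<open>p i\<close> alone had a positive coefficient, the dependence would express it as a convex
  combination of the other points.\<close>

lemma two_positive_coefficients:
  fixes p :: "'i::finite \<Rightarrow> 'a::real_vector"
  assumes dep: "(\<Sum>l\<in>UNIV. c l *\<^sub>R p l) = 0" "sum c UNIV = 0" "\<exists>l. c l \<noteq> 0"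
    and conv: "\<And>i. p i \<notin> convex hull (p ` (UNIV - {i}))"
  shows "card {l. c l > 0} \<ge> 2"
proof -
  have "\<exists>l. c l > 0"
  proof (rule ccontr)
    assume "\<not> (\<exists>l. c l > 0)"
    then have "\<forall>l\<in>UNIV. - c l = 0"
      using dep(2) by (subst sum_nonneg_eq_0_iff[symmetric]) (auto simp: sum_negf not_less)
    with dep(3) show False
      by simp
  qed
  then obtain i where i: "c i > 0"
    by blast
  have "\<exists>j. j \<noteq> i \<and> c j > 0"
  proof (rule ccontr)
    assume "\<not> ?thesis"
    then have le: "\<And>l. l \<noteq> i \<Longrightarrow> c l \<le> 0"
      by (meson not_le)
    have "(\<Sum>l\<in>UNIV - {i}. (- c l / c i) *\<^sub>R p l) \<in> convex hull (p ` (UNIV - {i}))"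
    proof (rule convex_sum)
      have "sum c (UNIV - {i}) = - c i"
        using dep(2) by (simp add: sum.remove[of UNIV i])
      then show "(\<Sum>l\<in>UNIV - {i}. - c l / c i) = 1"
        using i by (simp add: sum_negf flip: sum_divide_distrib)
    qed (use le i in \<open>auto intro: hull_inc simp: divide_nonpos_pos\<close>)
    also have "(\<Sum>l\<in>UNIV - {i}. (- c l / c i) *\<^sub>R p l)
        = (- 1 / c i) *\<^sub>R (\<Sum>l\<in>UNIV - {i}. c l *\<^sub>R p l)"
      by (simp add: scaleR_sum_right sum_negf)
    also have "(\<Sum>l\<in>UNIV - {i}. c l *\<^sub>R p l) = - c i *\<^sub>R p i"
      using dep(1) by (simp add: sum.remove[of UNIV i] eq_neg_iff_add_eq_0 add.commute)
    finally show False
      using conv[of i] i by simp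
  qed
  then obtain j where "j \<noteq> i" "c j > 0"
    by blast
  then have "{i, j} \<subseteq> {l. c l > 0}"
    using i by auto
  from card_mono[OF _ this] show ?thesis
    using \<open>j \<noteq> i\<close> by simp
qed

section \<open>The bound for unit vectors with a prescribed bipartition\<close>

text \<open>For a positive integer \<open>s\<close>, this is \<open>s!\<close> times the volume of the
  regular \<open>s\<close>-simplex inscribed in the unit sphere of \<open>\<real>\<^sup>s\<close>.\<close>

definition simplex_factor :: "real \<Rightarrow> real" where
  "simplex_factor x = (x + 1) powr ((x + 1) / 2) / x powr (x / 2)"

lemma simplex_factor_pos: "x > 0 \<Longrightarrow> simplex_factor x > 0"
  by (simp add: simplex_factor_def)

lemma simplex_factor_of_nat:
  assumes "s \<ge> 1"
  shows "sqrt (1 + 1 / real s) ^ Suc s * sqrt (real s) = simplex_factor (real s)"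
proof -
  have "sqrt (1 + 1 / real s) = ((1 + real s) / real s) powr (1 / 2)"
    using assms by (simp add: powr_half_sqrt field_simps)
  then have "sqrt (1 + 1 / real s) ^ Suc s = (((1 + real s) / real s) powr (1 / 2)) powr (real (Suc s))"
    using assms by (subst powr_realpow) auto
  also have "\<dots> = ((1 + real s) / real s) powr ((1 + real s) / 2)"
    by (simp add: powr_powr)
  also have "\<dots> = (1 + real s) powr ((1 + real s) / 2) / real s powr ((1 + real s) / 2)"
    by (simp add: powr_divide)
  also have "real s powr ((1 + real s) / 2) = real s powr (real s / 2) * sqrt (real s)"
    by (simp add: powr_half_sqrt[symmetric] add_divide_distrib flip: powr_add)
       (simp add: add.commute)
  finally show ?thesis
    using assms by (simp add: simplex_factor_def add.commute)
qed

context
  fixes p :: "'n::finite + 2 \<Rightarrow> real ^ 'n" and A :: "('n + 2) set" and s t :: nat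
  assumes unit: "\<And>l. norm (p l) = 1"
    and card: "card A = Suc s" "card (- A) = Suc t" and st: "s \<ge> 1" "t \<ge> 1"
begin

text \<open>The weight \<open>1 / sqrt s\<close> minimizes \<open>sqrt (1 + \<alpha>\<^sup>2) ^ Suc s / \<alpha>\<close>, the
  contribution of the class \<open>A\<close> to the quotient of Hadamard's bound by
  \<open>\<alpha> * \<beta>\<close>; likewise for the other class.\<close>

abbreviation "balanced_rows \<equiv> lifted_rows p A (1 / sqrt s) (1 / sqrt t)"

lemma inner_balanced_rows:
  "balanced_rows $ l \<bullet> balanced_rows $ l' = p l \<bullet> p l' +
     (if l \<in> A \<and> l' \<in> A then 1 / s else if l \<notin> A \<and> l' \<notin> A then 1 / t else 0)"
  by (simp add: lifted_rows_def inner_lift)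

text \<open>The lifted points of the two classes have lengths \<open>sqrt (1 + 1 / s)\<close> and
  \<open>sqrt (1 + 1 / t)\<close>, whatever the position of the points on the sphere.\<close>

lemma prod_norm_balanced_rows:
  "(\<Prod>l\<in>UNIV. norm (balanced_rows $ l)) * (sqrt s * sqrt t) = simplex_factor s * simplex_factor t"
proof -
  have norm: "norm (balanced_rows $ l) = (if l \<in> A then sqrt (1 + 1 / s) else sqrt (1 + 1 / t))" for l
    using unit[of l] by (simp add: norm_eq_sqrt_inner inner_balanced_rows)
  have "(\<Prod>l\<in>UNIV. norm (balanced_rows $ l)) = sqrt (1 + 1 / s) ^ Suc s * sqrt (1 + 1 / t) ^ Suc t"
    unfolding norm using card by (simp add: prod.If_cases Compl_eq del: power_Suc)
  then show ?thesis
    unfolding simplex_factor_of_nat[OF st(1), symmetric] simplex_factor_of_nat[OF st(2), symmetric]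
    by (simp add: mult_ac)
qed

lemma det_balanced_rows_le:
  "\<bar>det balanced_rows\<bar> * (sqrt s * sqrt t) \<le> simplex_factor s * simplex_factor t"
  unfolding prod_norm_balanced_rows[symmetric]
  by (intro mult_right_mono hadamard_inequality) simp

text \<open>Equality in Hadamard's inequality means that the lifted points are pairwise orthogonal, which
  prescribes all inner products of the points themselves.\<close>

lemma det_balanced_rows_eq_iff:
  "\<bar>det balanced_rows\<bar> * (sqrt s * sqrt t) = simplex_factor s * simplex_factor t \<longleftrightarrow>
    (\<forall>l l'. l \<noteq> l' \<longrightarrow>
      p l \<bullet> p l' = (if l \<in> A \<and> l' \<in> A then - 1 / s else if l \<notin> A \<and> l' \<notin> A then - 1 / t else 0))"
    (is "?E \<longleftrightarrow> ?G")
proof -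
  have "?E \<longleftrightarrow> \<bar>det balanced_rows\<bar> = (\<Prod>l\<in>UNIV. norm (balanced_rows $ l))"
    using st unfolding prod_norm_balanced_rows[symmetric] by simp
  moreover have "det balanced_rows \<noteq> 0" if ?E
    using that simplex_factor_pos[of "real s"] simplex_factor_pos[of "real t"] st by auto
  ultimately have "?E \<longleftrightarrow> (\<forall>l l'. l \<noteq> l' \<longrightarrow> balanced_rows $ l \<bullet> balanced_rows $ l' = 0)"
    using hadamard_equality_imp_orthogonal[of balanced_rows] det_orthogonal_rows[of balanced_rows]
    by blast
  also have "\<dots> \<longleftrightarrow> ?G"
    unfolding inner_balanced_rows by (intro iff_allI imp_cong refl) (auto simp: add_eq_0_iff2)
  finally show ?thesis .
qed

end

section \<open>Balanced bipartitions maximize the bound\<close>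

lemma simplex_factor_exp:
  "x > 0 \<Longrightarrow> simplex_factor x = exp ((x + 1) / 2 * ln (x + 1) - x / 2 * ln x)"
  by (simp add: simplex_factor_def powr_def exp_diff)

text \<open>The factor is log-concave: its logarithm is \<open>h (u + 1) - h u\<close> with
  \<open>h u = u / 2 * ln u\<close>, and the derivative \<open>(ln (u + 1) - ln u) / 2\<close> of this
  logarithm is strictly decreasing.  So the product grows as the two arguments, of fixed sum, approach each
  other.\<close>

lemma simplex_factor_product_less:
  assumes "0 < x" "x < y" "y \<le> D / 2"
  shows "simplex_factor x * simplex_factor (D - x) < simplex_factor y * simplex_factor (D - y)"
proof -
  define h where "h = (\<lambda>u :: real. u / 2 * ln u)"
  define g where "g = (\<lambda>u. h (u + 1) - h u)"
  have h': "(h has_real_derivative (ln u + 1) / 2) (at u)" if "u > 0" for u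
    unfolding h_def using that by (auto intro!: derivative_eq_intros simp: field_simps)
  have g': "(g has_real_derivative (ln (u + 1) - ln u) / 2) (at u)" if "u > 0" for u
    unfolding g_def using DERIV_diff[OF h'[of "u + 1", unfolded DERIV_shift] h'[of u]] that
    by (simp add: diff_divide_distrib add_divide_distrib)
  have "g x + g (D - x) < g y + g (D - y)"
  proof (rule DERIV_pos_imp_increasing_open[OF \<open>x < y\<close>])
    fix u assume u: "x < u" "u < y"
    have "((\<lambda>u. g u + g (D - u)) has_real_derivative
        (ln (u + 1) - ln u) / 2 + (ln (D - u + 1) - ln (D - u)) / 2 * (0 - 1)) (at u)"
      using u assms by (intro DERIV_add DERIV_chain2[of g] DERIV_diff DERIV_const DERIV_ident g') auto
    moreover have "ln ((D - u + 1) / (D - u)) < ln ((u + 1) / u)"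
      using u assms by (subst ln_less_cancel_iff) (auto simp: field_simps)
    then have "(ln (u + 1) - ln u) / 2 + (ln (D - u + 1) - ln (D - u)) / 2 * (0 - 1) > 0"
      using u assms by (simp add: ln_div)
    ultimately show "\<exists>z. ((\<lambda>u. g u + g (D - u)) has_real_derivative z) (at u) \<and> 0 < z"
      by blast
  next
    show "continuous_on {x..y} (\<lambda>u. g u + g (D - u))"
      unfolding g_def h_def using assms by (intro continuous_intros) auto
  qed
  then show ?thesis
    using assms by (simp add: simplex_factor_exp g_def h_def flip: exp_add)
qed

lemma simplex_factor_product_le:
  fixes s t k :: nat
  assumes "s \<ge> 1" "t \<ge> 1" and k: "k = (s + t) div 2"
  shows "simplex_factor s * simplex_factor t \<le> simplex_factor k * simplex_factor (s + t - k)"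
    and "simplex_factor s * simplex_factor t = simplex_factor k * simplex_factor (s + t - k)
          \<Longrightarrow> {s, t} = {k, s + t - k}"
proof -
  have *: "simplex_factor s * simplex_factor t < simplex_factor k * simplex_factor (s + t - k)
        \<or> s = k \<and> t = s + t - k"
    if "1 \<le> s" "s \<le> t" "k = (s + t) div 2" for s t k :: nat
  proof (cases "s = k")
    case False
    then have "s < k" "real k \<le> (real s + real t) / 2"
      using that by auto
    then show ?thesis
      using simplex_factor_product_less[of s k "real s + real t"] that by simp
  qed (use that in auto)
  have "simplex_factor s * simplex_factor t < simplex_factor k * simplex_factor (s + t - k)
        \<or> {s, t} = {k, s + t - k}"
  proof (cases "s \<le> t")
    case True
    then show ?thesis
      using *[of s t k] assms by auto
  next
    case False
    then show ?thesis
      using *[of t s k] assms by (auto simp: add.commute mult.commute)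
  qed
  moreover have "simplex_factor s * simplex_factor t = simplex_factor k * simplex_factor (s + t - k)"
    if "{s, t} = {k, s + t - k}"
    using that by (auto simp: doubleton_eq_iff)
  ultimately show
    "simplex_factor s * simplex_factor t \<le> simplex_factor k * simplex_factor (s + t - k)"
    "simplex_factor s * simplex_factor t = simplex_factor k * simplex_factor (s + t - k)
          \<Longrightarrow> {s, t} = {k, s + t - k}"
    by (auto simp: less_imp_le)
qed

text \<open>Taking the inner product of an affine dependence with one of its points isolates the coefficient
  of that point, multiplied by \<open>1 + 1 / s\<close>; hence the points are affinely
  independent.\<close>

lemma regular_simplex_of_inner:
  fixes S :: "'a::euclidean_space set"
  assumes "finite S" and card: "card S = Suc s" and "s \<ge> 1"
    and unit: "\<And>v. v \<in> S \<Longrightarrow> norm v = 1"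
    and inner: "\<And>v w. v \<in> S \<Longrightarrow> w \<in> S \<Longrightarrow> v \<noteq> w \<Longrightarrow> v \<bullet> w = - 1 / s"
  shows "regular_simplex s (convex hull S)" "inscribed (convex hull S)"
proof -
  have vert: "vertices (convex hull S) \<subseteq> S"
    unfolding vertices_def by (rule extreme_points_of_convex_hull)
  then show "inscribed (convex hull S)"
    using unit by (auto simp: inscribed_def)
  have "\<not> affine_dependent S"
  proof
    assume "affine_dependent S"
    then obtain u v where u: "sum u S = 0" "v \<in> S" "u v \<noteq> 0" "(\<Sum>w\<in>S. u w *\<^sub>R w) = 0"
      using affine_dependent_explicit_finite[OF \<open>finite S\<close>] by auto
    have "0 = (\<Sum>w\<in>S. u w *\<^sub>R w) \<bullet> v"
      by (simp add: u)
    also have "\<dots> = u v * (v \<bullet> v) + (\<Sum>w\<in>S - {v}. u w * (w \<bullet> v))"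
      unfolding inner_sum_left inner_scaleR_left by (rule sum.remove[OF \<open>finite S\<close> \<open>v \<in> S\<close>])
    also have "v \<bullet> v = 1"
      using unit[OF \<open>v \<in> S\<close>] by (simp add: norm_eq_1)
    also have "(\<Sum>w\<in>S - {v}. u w * (w \<bullet> v)) = (\<Sum>w\<in>S - {v}. u w) * (- 1 / s)"
      unfolding sum_distrib_right
      by (intro sum.cong refl arg_cong[where f = "(*) _"] inner) (use \<open>v \<in> S\<close> in auto)
    also have "(\<Sum>w\<in>S - {v}. u w) = - u v"
      using u(1) by (simp add: sum.remove[OF \<open>finite S\<close> \<open>v \<in> S\<close>])
    also have "u v * 1 + - u v * (- 1 / s) = u v * (1 + 1 / s)"
      by (simp add: algebra_simps)
    finally have "1 + 1 / real s = 0"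
      using u(3) by simp
    moreover have "1 + 1 / real s > 0"
      by (simp add: add_pos_nonneg)
    ultimately show False
      by simp
  qed
  then have "int s simplex (convex hull S)"
    using card by (auto simp: simplex_def)
  moreover have "dist v w = sqrt (2 + 2 / s)" if "v \<in> S" "w \<in> S" "v \<noteq> w" for v w
    using inner[OF that] inner[OF that(2,1)] unit[OF that(1)] unit[OF that(2)] that(3)
    by (simp add: dist_norm norm_eq_sqrt_inner[of "v - w"] inner_diff_left inner_diff_right norm_eq_1)
  ultimately show "regular_simplex s (convex hull S)"
    unfolding regular_simplex_def using vert by blast
qed

section \<open>Configurations attaining the bound\<close>

text \<open>These are the inner products of the vertices of two regular simplices centered at the origin, of
  dimensions \<open>s\<close> and \<open>t\<close>, in orthogonal subspaces.\<close>

definition balanced_configuration ::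
    "('i \<Rightarrow> 'a::euclidean_space) \<Rightarrow> 'i set \<Rightarrow> nat \<Rightarrow> nat \<Rightarrow> bool" where
  "balanced_configuration p A s t \<longleftrightarrow>
     (\<forall>l. norm (p l) = 1) \<and>
     (\<forall>l l'. l \<noteq> l' \<longrightarrow> p l \<bullet> p l' =
        (if l \<in> A \<and> l' \<in> A then - 1 / s else if l \<notin> A \<and> l' \<notin> A then - 1 / t else 0))"

lemma balanced_configuration_norm: "balanced_configuration p A s t \<Longrightarrow> norm (p l) = 1"
  by (simp add: balanced_configuration_def)

lemma balanced_configuration_inner:
  "balanced_configuration p A s t \<Longrightarrow> l \<noteq> l' \<Longrightarrow> p l \<bullet> p l' =
     (if l \<in> A \<and> l' \<in> A then - 1 / s else if l \<notin> A \<and> l' \<notin> A then - 1 / t else 0)"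
  by (simp add: balanced_configuration_def)

lemma balanced_configuration_Compl:
  "balanced_configuration p A s t \<Longrightarrow> balanced_configuration p (- A) t s"
  by (auto simp: balanced_configuration_def)

lemma balanced_configuration_inj:
  assumes "balanced_configuration p A s t"
  shows "inj p"
proof (rule injI, rule ccontr)
  fix l l' assume "p l = p l'" "l \<noteq> l'"
  then have "p l \<bullet> p l' = 1"
    using balanced_configuration_norm[OF assms, of l'] by (simp add: norm_eq_1)
  moreover have "p l \<bullet> p l' \<le> 0"
    unfolding balanced_configuration_inner[OF assms \<open>l \<noteq> l'\<close>] by simp
  ultimately show False
    by simp
qed

lemma balanced_configuration_regular_simplex:
  fixes p :: "'i::finite \<Rightarrow> 'a::euclidean_space"
  assumes p: "balanced_configuration p A s t" and "card A = Suc s" "s \<ge> 1"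
  shows "regular_simplex s (convex hull (p ` A))" "inscribed (convex hull (p ` A))"
proof -
  have "card (p ` A) = Suc s"
    using assms(2) balanced_configuration_inj[OF p] by (metis card_image inj_on_subset subset_UNIV)
  moreover have "v \<bullet> w = - 1 / s" if "v \<in> p ` A" "w \<in> p ` A" "v \<noteq> w" for v w
  proof -
    obtain l l' where "l \<in> A" "l' \<in> A" "v = p l" "w = p l'" "l \<noteq> l'"
      using \<open>v \<in> p ` A\<close> \<open>w \<in> p ` A\<close> \<open>v \<noteq> w\<close> by blast
    then show ?thesis
      using balanced_configuration_inner[OF p, of l l'] by simp
  qed
  moreover have "norm v = 1" if "v \<in> p ` A" for v
    using that balanced_configuration_norm[OF p] by auto
  ultimately show "regular_simplex s (convex hull (p ` A))" "inscribed (convex hull (p ` A))"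
    using regular_simplex_of_inner[OF _ _ \<open>s \<ge> 1\<close>, of "p ` A"] by simp_all
qed

lemma balanced_configuration_decomposition:
  fixes p :: "'i::finite \<Rightarrow> 'a::euclidean_space"
  assumes p: "balanced_configuration p A s t"
    and card: "card A = Suc s" "card (- A) = Suc t" and st: "s \<ge> 1" "t \<ge> 1"
  obtains P1 P2 U V where "convex hull (range p) = convex hull (P1 \<union> P2)"
    "regular_simplex s P1" "inscribed P1" "P1 \<subseteq> U"
    "regular_simplex t P2" "inscribed P2" "P2 \<subseteq> V" "orthogonal_subspaces U V"
proof
  show "convex hull (range p) = convex hull (convex hull (p ` A) \<union> convex hull (p ` (- A)))"
  proof -
    have "range p = p ` A \<union> p ` (- A)"
      by auto
    then show ?thesis
      using hull_Un[of convex "p ` A" "p ` (- A)"] by (simp add: convex_Inter)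
  qed
  show "regular_simplex s (convex hull (p ` A))" "inscribed (convex hull (p ` A))"
    by (fact balanced_configuration_regular_simplex[OF p card(1) st(1)])+
  show "regular_simplex t (convex hull (p ` (- A)))" "inscribed (convex hull (p ` (- A)))"
    by (fact balanced_configuration_regular_simplex[OF balanced_configuration_Compl[OF p] card(2) st(2)])+
  show "convex hull (p ` A) \<subseteq> span (p ` A)" "convex hull (p ` (- A)) \<subseteq> span (p ` (- A))"
    by (fact convex_hull_subset_span)+
  have *: "orthogonal (p l) (p l')" if "l \<in> A" "l' \<notin> A" for l l'
    using balanced_configuration_inner[OF p, of l l'] that by (auto simp: orthogonal_def)
  have "orthogonal u (p l')" if "u \<in> span (p ` A)" "l' \<notin> A" for u l'
  proof -
    have "orthogonal (p l') u"
    proof (rule orthogonal_to_span[OF that(1)])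
      show "orthogonal (p l') y" if "y \<in> p ` A" for y
        using * \<open>l' \<notin> A\<close> that by (metis imageE orthogonal_commute)
    qed
    then show ?thesis
      by (simp add: orthogonal_commute)
  qed
  then have "orthogonal u v" if "u \<in> span (p ` A)" "v \<in> span (p ` (- A))" for u v
    using that by (intro orthogonal_to_span[OF that(2)]) auto
  then show "orthogonal_subspaces (span (p ` A)) (span (p ` (- A)))"
    by (simp add: orthogonal_subspaces_def)
qed

section \<open>Volume bound for inscribed polytopes\<close>

text \<open>The bipartition is the Radon partition of the vertices.  Convex position puts at least two
  vertices into each class, so that \<open>s\<close> and \<open>t\<close> are positive and the
  weights \<open>1 / sqrt s\<close> and \<open>1 / sqrt t\<close> make sense.  Vertices with
  coefficient \<open>0\<close> in the dependence, as in a pyramid, may join either class; they are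
  put into \<open>- A\<close>.\<close>

lemma inscribed_polytope_volume_bound:
  fixes P :: "(real ^ 'n) set"
  assumes "P \<in> inscribed_polytopes (CARD('n) + 2)"
  obtains p :: "'n + 2 \<Rightarrow> real ^ 'n" and A and s t :: nat
  where "P = convex hull (range p)" "card A = Suc s" "card (- A) = Suc t" "s \<ge> 1" "t \<ge> 1"
    "s + t = CARD('n)"
    "measure lebesgue P \<le> simplex_factor s * simplex_factor t / fact CARD('n)"
    "measure lebesgue P = simplex_factor s * simplex_factor t / fact CARD('n)
       \<longrightarrow> balanced_configuration p A s t"
proof -
  have P: "polytope P" "card (vertices P) = CARD('n + 2)" "vertices P \<subseteq> sphere 0 1"
    using assms by (auto simp: inscribed_polytopes_def inscribed_def)
  then have "finite (vertices P)"
    by (metis card.infinite zero_less_card_finite less_irrefl)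
  then obtain p :: "'n + 2 \<Rightarrow> real ^ 'n" where p: "bij_betw p UNIV (vertices P)"
    using finite_same_card_bij[of "UNIV :: ('n + 2) set" "vertices P"] P(2) by auto
  have P_hull: "P = convex hull (range p)"
    using P(1) Krein_Milman_Minkowski[of P] p
    by (simp add: polytope_imp_compact polytope_imp_convex bij_betw_imp_surj_on vertices_def)
  have unit: "norm (p l) = 1" for l
    using P(3) bij_betwE[OF p] by fastforce
  have conv: "p i \<notin> convex hull (p ` (UNIV - {i}))" for i
  proof -
    have ext: "p i extreme_point_of P"
      using bij_betwE[OF p] by (auto simp: vertices_def)
    have "p ` (UNIV - {i}) \<subseteq> P - {p i}"
      using bij_betw_imp_inj_on[OF p] by (auto simp: P_hull hull_inc dest: injD)
    then have "convex hull (p ` (UNIV - {i})) \<subseteq> P - {p i}"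
      using ext extreme_point_of_stillconvex[OF polytope_imp_convex[OF P(1)]]
      by (intro hull_minimal) auto
    then show ?thesis
      by blast
  qed
  obtain c where c: "(\<Sum>l\<in>UNIV. c l *\<^sub>R p l) = 0" "sum c UNIV = 0" "\<exists>l. c l \<noteq> 0"
    using exists_affine_dependence[of p] .
  define A where "A = {l. c l > 0}"
  have A: "card A \<ge> 2"
    unfolding A_def by (rule two_positive_coefficients[OF c conv])
  have "card {l. - c l > 0} \<ge> 2"
    using c by (intro two_positive_coefficients[OF _ _ _ conv]) (auto simp: sum_negf)
  moreover have "card {l. - c l > 0} \<le> card (- A)"
    by (intro card_mono) (auto simp: A_def)
  ultimately have B: "card (- A) \<ge> 2"
    by simp
  define s t where "s = card A - 1" and "t = card (- A) - 1"
  have st: "card A = Suc s" "card (- A) = Suc t" "s \<ge> 1" "t \<ge> 1"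
    using A B by (auto simp: s_def t_def)
  have "card A + card (- A) = CARD('n + 2)"
    using card_Un_disjoint[of A "- A"] by (simp add: Compl_partition)
  then have sum: "s + t = CARD('n)"
    using st by simp
  let ?N = "lifted_rows p A (1 / sqrt s) (1 / sqrt t)"
  have "\<exists>l. c l > 0"
    using A by (metis A_def Collect_empty_eq card.empty not_numeral_le_zero)
  then have le: "measure lebesgue P \<le> \<bar>det ?N\<bar> * (sqrt s * sqrt t) / fact CARD('n)"
    using volume_le_det[OF c(1,2), of A "1 / sqrt s" "1 / sqrt t"] st
    by (simp add: A_def P_hull field_simps)
  have bound: "\<bar>det ?N\<bar> * (sqrt s * sqrt t) \<le> simplex_factor s * simplex_factor t"
    by (rule det_balanced_rows_le[OF unit st])
  show ?thesis
  proof (rule that[OF P_hull st sum])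
    show "measure lebesgue P \<le> simplex_factor s * simplex_factor t / fact CARD('n)"
      using le bound by (smt (verit) divide_right_mono fact_ge_zero)
    show "measure lebesgue P = simplex_factor s * simplex_factor t / fact CARD('n)
        \<longrightarrow> balanced_configuration p A s t"
    proof
      assume "measure lebesgue P = simplex_factor s * simplex_factor t / fact CARD('n)"
      then have "\<bar>det ?N\<bar> * (sqrt s * sqrt t) = simplex_factor s * simplex_factor t"
        using le bound by (simp add: divide_le_cancel)
      then show "balanced_configuration p A s t"
        unfolding det_balanced_rows_eq_iff[OF unit st] balanced_configuration_def using unit by blast
    qed
  qed
qed

section \<open>Existence and volume of balanced configurations\<close>

text \<open>In \<open>\<real>\<^sup>d\<^sup>+\<^sup>2\<close>, subtract from each basis vector the barycenter of its class.
  The differences lie in the orthogonal complement of the two class sums, which has dimension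
  \<open>d\<close> and is therefore isometric to \<open>\<real>\<^sup>d\<close>; scaled to unit length
  they have the required inner products.\<close>

lemma exists_balanced_configuration:
  fixes A :: "('n::finite + 2) set"
  assumes card: "card A = Suc s" "card (- A) = Suc t" and st: "s \<ge> 1" "t \<ge> 1"
  obtains p :: "'n + 2 \<Rightarrow> real ^ 'n" where "balanced_configuration p A s t"
proof -
  let ?e = "\<lambda>l. axis l 1 :: real ^ ('n + 2)"
  define w where "w = (\<lambda>B :: ('n + 2) set. \<Sum>l\<in>B. ?e l)"
  have ee: "?e l \<bullet> ?e l' = (if l = l' then 1 else 0)" for l l'
    by (simp add: inner_axis_axis)
  have ew: "?e l \<bullet> w B = (if l \<in> B then 1 else 0)" for l B
    by (simp add: w_def inner_sum_right ee)
  have ww: "w B \<bullet> w C = card (B \<inter> C)" for B C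
  proof -
    have "w B \<bullet> w C = (\<Sum>l\<in>B. ?e l \<bullet> w C)"
      by (subst w_def) (simp only: inner_sum_left)
    then show ?thesis
      by (simp add: ew sum.If_cases)
  qed
  define W where "W = {w A, w (- A)}"
  have W0: "w A \<bullet> w (- A) = 0" "w A \<noteq> 0" "w (- A) \<noteq> 0"
    using ww[of A "- A"] ww[of A A] ww[of "- A" "- A"] card by auto
  then have "w A \<noteq> w (- A)"
    by auto
  then have "card W = 2"
    by (simp add: W_def)
  moreover have "independent W"
    using W0 by (intro pairwise_orthogonal_independent)
      (auto simp: W_def pairwise_def orthogonal_def inner_commute)
  ultimately have "dim (span W) = 2"
    by (simp add: dim_eq_card_independent)
  define S where "S = {y \<in> UNIV. \<forall>x\<in>span W. orthogonal x y}"
  have "dim S + dim (span W) = DIM(real ^ ('n + 2))"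
    unfolding S_def using dim_subspace_orthogonal_to_vectors[of "span W" UNIV] by simp
  then have "dim S \<le> dim (UNIV :: (real ^ 'n) set)"
    using \<open>dim (span W) = 2\<close> by simp
  moreover have "subspace S"
    by (auto simp: S_def subspace_def orthogonal_def inner_add_right)
  ultimately obtain f :: "real ^ ('n + 2) \<Rightarrow> real ^ 'n"
    where f: "linear f" "\<And>x. x \<in> S \<Longrightarrow> norm (f x) = norm x"
    using isometry_subset_subspace[of S UNIV] by (metis subspace_UNIV)
  have inner_f: "f x \<bullet> f y = x \<bullet> y" if "x \<in> S" "y \<in> S" for x y
    using f(2)[OF that(1)] f(2)[OF that(2)] f(2)[OF subspace_add[OF \<open>subspace S\<close> that]]
    by (simp add: dot_norm linear_add[OF f(1)])
  have we: "w B \<bullet> ?e l = (if l \<in> B then 1 else 0)" for l B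
    using ew[of l B] by (simp only: inner_commute)
  define r where "r = (\<lambda>n B l. sqrt (1 + 1 / real n) *\<^sub>R (?e l - (1 / real (Suc n)) *\<^sub>R w B))"
  have r_same: "r n B l \<bullet> r n B l' = (if l = l' then 1 else - 1 / real n)"
    if "card B = Suc n" "n \<ge> 1" "l \<in> B" "l' \<in> B" for n B l l'
  proof -
    define a where "a = 1 / real (Suc n)"
    have "real n + real n * real n \<noteq> 0"
      using \<open>n \<ge> 1\<close> by (metis add_nonneg_eq_0_iff mult_nonneg_nonneg not_one_le_zero of_nat_0_le_iff of_nat_eq_0_iff)
    then have "a * real (Suc n) = 1" "(1 + 1 / real n) * (1 - a) = 1" "(1 + 1 / real n) * (0 - a) = - 1 / real n"
      using \<open>n \<ge> 1\<close> by (simp_all add: a_def field_simps)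
    have "(?e l - a *\<^sub>R w B) \<bullet> (?e l' - a *\<^sub>R w B)
        = (if l = l' then 1 else 0) - a - a + a * (a * real (Suc n))"
      using that
      by (simp add: inner_diff_left inner_diff_right ee ew we ww right_diff_distrib del: of_nat_Suc)
    also have "\<dots> = (if l = l' then 1 else 0) - a"
      using \<open>a * real (Suc n) = 1\<close> by simp
    finally have "r n B l \<bullet> r n B l' = (1 + 1 / real n) * ((if l = l' then 1 else 0) - a)"
      unfolding r_def a_def[symmetric] inner_scaleR_left inner_scaleR_right
      by (simp flip: mult.assoc)
    then show ?thesis
      using \<open>(1 + 1 / real n) * (1 - a) = 1\<close> \<open>(1 + 1 / real n) * (0 - a) = - 1 / real n\<close>
      by (cases "l = l'") (simp_all only: if_True if_False simp_thms)
  qed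
  have r_diff: "r n B l \<bullet> r n' C l' = 0"
    if "l \<in> B" "l' \<in> C" "B \<inter> C = {}" for n B l n' C l'
  proof -
    have "l \<noteq> l'" "l \<notin> C" "l' \<notin> B"
      using that by auto
    then show ?thesis
      using that by (simp add: r_def inner_diff_left inner_diff_right ee ew we ww)
  qed
  have r_w: "r n B l \<bullet> w B = 0" "B \<inter> C = {} \<Longrightarrow> r n B l \<bullet> w C = 0"
    if "card B = Suc n" "l \<in> B" for n B l C
  proof -
    show "r n B l \<bullet> w B = 0"
      using that by (simp add: r_def inner_diff_left ew ww del: of_nat_Suc)
    assume "B \<inter> C = {}"
    then have "l \<notin> C"
      using that by auto
    then show "r n B l \<bullet> w C = 0"
      using \<open>B \<inter> C = {}\<close> by (simp add: r_def inner_diff_left ew ww)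
  qed
  define q where "q = (\<lambda>l. if l \<in> A then r s A l else r t (- A) l)"
  have q_in: "q l \<in> S" for l
  proof -
    have "q l \<bullet> w A = 0" "q l \<bullet> w (- A) = 0"
      using r_w(1)[OF card(1)] r_w(1)[OF card(2)] r_w(2)[OF card(1), of l "- A"]
        r_w(2)[OF card(2), of l A] by (simp_all add: q_def)
    then have "orthogonal (q l) x" if "x \<in> span W" for x
      using that by (intro orthogonal_to_span[OF that]) (auto simp: W_def orthogonal_def)
    then show ?thesis
      by (auto simp: S_def orthogonal_commute)
  qed
  have qq: "q l \<bullet> q l' = (if l = l' then 1 else if l \<in> A \<and> l' \<in> A then - 1 / s
      else if l \<notin> A \<and> l' \<notin> A then - 1 / t else 0)" for l l'
    using r_same[OF card(1) st(1), of l l'] r_same[OF card(2) st(2), of l l']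
      r_diff[of l A l' "- A"] r_diff[of l "- A" l' A]
    by (cases "l \<in> A"; cases "l' \<in> A") (auto simp: q_def)
  have "balanced_configuration (\<lambda>l. f (q l)) A s t"
    unfolding balanced_configuration_def norm_eq_1 inner_f[OF q_in q_in] qq by simp
  then show ?thesis
    by (rule that)
qed

lemma extreme_point_of_unit_norm:
  fixes S :: "'a::euclidean_space set"
  assumes "S \<subseteq> cball 0 1" "x \<in> S" "norm x = 1"
  shows "x extreme_point_of S"
  unfolding extreme_point_of_def
proof (intro conjI ballI notI)
  fix a b assume "a \<in> S" "b \<in> S" "x \<in> open_segment a b"
  then have "norm x < norm a \<or> norm x < norm b"
    using dist_decreases_open_segment[of x a b 0] by simp
  moreover have "norm a \<le> 1" "norm b \<le> 1"
    using \<open>a \<in> S\<close> \<open>b \<in> S\<close> assms(1) by auto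
  ultimately show False
    using assms(3) by simp
qed fact

text \<open>For a balanced configuration the covering simplices overlap only in null sets: those omitting
  \<open>p i\<close> and \<open>p j\<close> lie on different sides of the hyperplane through the origin
  orthogonal to \<open>p i - p j\<close>.  So the sum of their volumes, which is the value of the
  bound, is at most the volume of the hull.\<close>

lemma volume_balanced_configuration:
  fixes p :: "'n::finite + 2 \<Rightarrow> real ^ 'n"
  assumes p: "balanced_configuration p A s t"
    and card: "card A = Suc s" "card (- A) = Suc t" and st: "s \<ge> 1" "t \<ge> 1"
  shows "simplex_factor s * simplex_factor t / fact CARD('n) \<le> measure lebesgue (convex hull (range p))"
proof -
  note inner = balanced_configuration_inner[OF p]
  have unit: "p l \<bullet> p l = 1" for l
    using balanced_configuration_norm[OF p, of l] by (simp add: norm_eq_1)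
  have sum0: "(\<Sum>l\<in>B. p l) = 0"
    if p: "balanced_configuration p B s t" and card: "card B = Suc s" and "s \<ge> 1" for B s t
  proof -
    have "p l \<bullet> (\<Sum>l'\<in>B. p l') = 0" if "l \<in> B" for l
    proof -
      \<comment> \<open>The \<open>s\<close> other points of the class contribute \<open>- 1 / s\<close> each.\<close>
      have "p l \<bullet> (\<Sum>l'\<in>B. p l') = p l \<bullet> p l + (\<Sum>l'\<in>B - {l}. p l \<bullet> p l')"
        using that by (simp add: inner_sum_right inner_add_right sum.remove[of B l])
      also have "(\<Sum>l'\<in>B - {l}. p l \<bullet> p l') = (\<Sum>l'\<in>B - {l}. - 1 / s)"
        using \<open>l \<in> B\<close>
        by (intro sum.cong refl, subst balanced_configuration_inner[OF p]) auto
      finally show ?thesis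
        using unit[of l] card \<open>l \<in> B\<close> \<open>s \<ge> 1\<close> by simp
    qed
    then have "(\<Sum>l\<in>B. p l) \<bullet> (\<Sum>l'\<in>B. p l') = 0"
      unfolding inner_sum_left by simp
    then show ?thesis
      by simp
  qed
  \<comment> \<open>Both classes have their barycenter at the origin, which gives the affine dependence.\<close>
  define c where "c = (\<lambda>l. if l \<in> A then 1 / real (Suc s) else - 1 / real (Suc t))"
  have "(\<Sum>l\<in>UNIV. c l *\<^sub>R p l) = (\<Sum>l\<in>A. c l *\<^sub>R p l) + (\<Sum>l\<in>-A. c l *\<^sub>R p l)"
    using sum.subset_diff[of A UNIV "\<lambda>l. c l *\<^sub>R p l"] by (simp add: Compl_eq_Diff_UNIV add.commute)
  also have "(\<Sum>l\<in>A. c l *\<^sub>R p l) = (1 / real (Suc s)) *\<^sub>R (\<Sum>l\<in>A. p l)"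
    by (simp add: c_def scaleR_sum_right)
  also have "(\<Sum>l\<in>-A. c l *\<^sub>R p l) = (- 1 / real (Suc t)) *\<^sub>R (\<Sum>l\<in>-A. p l)"
    by (simp add: c_def scaleR_sum_right)
  finally have dep: "(\<Sum>l\<in>UNIV. c l *\<^sub>R p l) = 0"
    using sum0[OF p card(1) st(1)] sum0[OF balanced_configuration_Compl[OF p] card(2) st(2)] by simp
  have sums: "sum c A = 1" "sum c (- A) = - 1"
    using card by (simp_all add: c_def)
  let ?N = "lifted_rows p A (1 / sqrt s) (1 / sqrt t)"
  define V where "V = \<bar>det ?N\<bar> * (sqrt s * sqrt t) / fact CARD('n)"
  have vol: "measure lebesgue (convex hull (p ` (UNIV - {i}))) = V / Suc s" if "i \<in> A" for i
    using measure_omit_vertex[OF dep sums, of "1 / sqrt s" "1 / sqrt t" i] st that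
    by (simp add: c_def V_def)
  have half: "convex hull (p ` (UNIV - {i})) \<subseteq> {x. (p i - p j) \<bullet> x \<le> 0}"
    if "i \<in> A" "j \<in> A" "i \<noteq> j" for i j
  proof (rule hull_minimal)
    show "p ` (UNIV - {i}) \<subseteq> {x. (p i - p j) \<bullet> x \<le> 0}"
    proof clarsimp
      fix l assume "l \<noteq> i"
      have "- 1 \<le> 1 / real s"
        by (rule order_trans[of _ 0]) simp_all
      with \<open>l \<noteq> i\<close> show "(p i - p j) \<bullet> p l \<le> 0"
        using that inner[of i l] inner[of j l] unit[of j]
        by (cases "l = j") (auto simp: inner_diff_left)
    qed
  qed (rule convex_halfspace_le)
  have "simplex_factor s * simplex_factor t = \<bar>det ?N\<bar> * (sqrt s * sqrt t)"
    using balanced_configuration_norm[OF p] inner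
    by (subst det_balanced_rows_eq_iff[OF _ card st, THEN iffD2]) auto
  then have "simplex_factor s * simplex_factor t / fact CARD('n) = V"
    by (simp add: V_def)
  also have "\<dots> = (\<Sum>i\<in>A. measure lebesgue (convex hull (p ` (UNIV - {i}))))"
    using vol card(1) by simp
  also have "\<dots> = measure lebesgue (\<Union>i\<in>A. convex hull (p ` (UNIV - {i})))"
  proof (rule measure_negligible_finite_Union_image[symmetric])
    show "pairwise (\<lambda>i j. negligible (convex hull (p ` (UNIV - {i})) \<inter> convex hull (p ` (UNIV - {j})))) A"
    proof (rule pairwiseI)
      fix i j assume ij: "i \<in> A" "j \<in> A" "i \<noteq> j"
      have "p i - p j \<noteq> 0"
        using ij balanced_configuration_inj[OF p] by (auto dest: injD)
      then have "negligible {x. (p i - p j) \<bullet> x = 0}"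
        by (intro negligible_hyperplane) simp
      moreover have "convex hull (p ` (UNIV - {i})) \<inter> convex hull (p ` (UNIV - {j}))
          \<subseteq> {x. (p i - p j) \<bullet> x = 0}"
        using half[OF ij] half[OF ij(2,1)] ij(3) by (fastforce simp: inner_diff_left)
      ultimately show
        "negligible (convex hull (p ` (UNIV - {i})) \<inter> convex hull (p ` (UNIV - {j})))"
        by (rule negligible_subset)
    qed
  qed (auto intro: lmeasurable_convex_hull_finite)
  also have "\<dots> \<le> measure lebesgue (convex hull (range p))"
    by (intro measure_mono_fmeasurable fmeasurableD fmeasurable.finite_UN lmeasurable_convex_hull_finite
        UN_least hull_mono) auto
  finally show ?thesis .
qed

text \<open>All points have unit norm and are therefore extreme; full dimension follows from the positive
  volume.\<close>

lemma balanced_configuration_inscribed_polytope: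
  fixes p :: "'n::finite + 2 \<Rightarrow> real ^ 'n"
  assumes p: "balanced_configuration p A s t"
    and card: "card A = Suc s" "card (- A) = Suc t" and st: "s \<ge> 1" "t \<ge> 1"
  shows "convex hull (range p) \<in> inscribed_polytopes (CARD('n) + 2)"
proof -
  let ?P = "convex hull (range p)"
  have unit: "norm (p l) = 1" for l
    by (rule balanced_configuration_norm[OF p])
  have "?P \<subseteq> cball 0 1"
    using unit by (intro hull_minimal) auto
  then have "p l extreme_point_of ?P" for l
    using unit by (intro extreme_point_of_unit_norm) (auto intro: hull_inc)
  then have vert: "vertices ?P = range p"
    using extreme_points_of_convex_hull[of "range p"] by (auto simp: vertices_def)
  have "card (range p) = CARD('n) + 2"
    using balanced_configuration_inj[OF p] by (simp add: card_image)
  moreover have "aff_dim ?P = int CARD('n)"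
  proof -
    have "0 < simplex_factor s * simplex_factor t / fact CARD('n)"
      using st by (simp add: simplex_factor_pos)
    then have "measure lebesgue ?P \<noteq> 0"
      using volume_balanced_configuration[OF assms] by linarith
    then have "interior ?P \<noteq> {}"
      using negligible_convex_interior[of ?P] negligible_imp_measure0 by blast
    then show ?thesis
      using aff_dim_nonempty_interior[of ?P] by simp
  qed
  moreover have "polytope ?P"
    unfolding polytope_def by (intro exI[of _ "range p"]) simp
  ultimately show ?thesis
    using unit by (auto simp: inscribed_polytopes_def inscribed_def vert)
qed

section \<open>Maximum-volume inscribed polytopes with d + 2 vertices\<close>

theorem theorem2:
  fixes d k m :: nat
  assumes "d = CARD('n::finite)" and "d \<ge> 2"
    and "k = nat \<lfloor>real d / 2\<rfloor>" and "m = nat \<lceil>real d / 2\<rceil>"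
  shows "(\<forall>P :: (real ^ 'n) set. has_maximal_volume P (inscribed_polytopes (d + 2)) \<longrightarrow>
            (\<exists>P1 P2 U V. P = convex hull (P1 \<union> P2) \<and>
               regular_simplex k P1 \<and> inscribed P1 \<and> P1 \<subseteq> U \<and>
               regular_simplex m P2 \<and> inscribed P2 \<and> P2 \<subseteq> V \<and>
               orthogonal_subspaces U V))
       \<and> (\<exists>P :: (real ^ 'n) set. has_maximal_volume P (inscribed_polytopes (d + 2)))
       \<and> max_volume TYPE('n) (d + 2) =
           1 / fact d *
           ((real k + 1) powr ((real k + 1) / 2) * (real m + 1) powr ((real m + 1) / 2) /
            (real k powr (real k / 2) * real m powr (real m / 2)))"
proof -
  let ?F = "inscribed_polytopes (d + 2) :: (real ^ 'n) set set"
  define V where "V = simplex_factor k * simplex_factor m / fact d"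
  have k: "k = d div 2"
    using assms(3) floor_divide_of_nat_eq[of d 2, where 'a = real] by simp
  have "d = 2 * (d div 2) + d mod 2" "d mod 2 < 2"
    by simp_all
  then have "\<lceil>real d / 2\<rceil> = int (d - d div 2)"
    by (intro ceiling_unique) linarith+
  then have m: "m = d - k"
    using assms(4) k by simp
  have km: "k \<ge> 1" "m \<ge> 1" "k + m = d"
    using k m \<open>d \<ge> 2\<close> by auto
  have bound: "measure lebesgue P \<le> V \<and> (measure lebesgue P = V \<longrightarrow>
      (\<exists>(p :: 'n + 2 \<Rightarrow> real ^ 'n) A. P = convex hull (range p)
         \<and> card A = Suc k \<and> card (- A) = Suc m \<and> balanced_configuration p A k m))"
    if PF: "P \<in> ?F" for P
  proof -
    obtain p :: "'n + 2 \<Rightarrow> real ^ 'n" and A and s t :: nat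
      where p: "P = convex hull (range p)" and card: "card A = Suc s" "card (- A) = Suc t"
        and st: "s \<ge> 1" "t \<ge> 1" "s + t = d"
        and le: "measure lebesgue P \<le> simplex_factor s * simplex_factor t / fact d"
        and eq: "measure lebesgue P = simplex_factor s * simplex_factor t / fact d
          \<longrightarrow> balanced_configuration p A s t"
      using inscribed_polytope_volume_bound[OF PF[unfolded assms(1)], folded assms(1)] by blast
    have prod: "simplex_factor s * simplex_factor t \<le> simplex_factor k * simplex_factor m"
      "simplex_factor s * simplex_factor t = simplex_factor k * simplex_factor m
        \<Longrightarrow> {s, t} = {k, m}"
      using simplex_factor_product_le[OF st(1,2), of k] st(3) k m by simp_all
    then have le': "simplex_factor s * simplex_factor t / fact d \<le> V"
      by (simp add: V_def divide_right_mono)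
    show ?thesis
    proof (intro conjI impI)
      show "measure lebesgue P \<le> V"
        using le le' by simp
      assume "measure lebesgue P = V"
      then have V: "simplex_factor s * simplex_factor t / fact d = V"
        using le le' by simp
      then have conf: "balanced_configuration p A s t"
        using eq \<open>measure lebesgue P = V\<close> by simp
      have "{s, t} = {k, m}"
        using V prod(2) by (simp add: V_def)
      then consider "s = k" "t = m" | "s = m" "t = k"
        by (auto simp: doubleton_eq_iff)
      then show "\<exists>(p :: 'n + 2 \<Rightarrow> real ^ 'n) A. P = convex hull (range p)
         \<and> card A = Suc k \<and> card (- A) = Suc m \<and> balanced_configuration p A k m"
      proof cases
        case 1
        then show ?thesis
          using p card conf by blast
      next
        case 2
        then show ?thesis
          using p card balanced_configuration_Compl[OF conf]
          by (intro exI[of _ p] exI[of _ "- A"]) simp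
      qed
    qed
  qed
  have "Suc k \<le> card (UNIV :: ('n + 2) set)"
    using km assms(1) by simp
  then obtain A :: "('n + 2) set" where A: "card A = Suc k"
    using obtain_subset_with_card_n by metis
  moreover have "card A + card (- A) = CARD('n + 2)"
    using card_Un_disjoint[of A "- A"] by (simp add: Compl_partition)
  ultimately have A': "card (- A) = Suc m"
    using km assms(1) by simp
  obtain p :: "'n + 2 \<Rightarrow> real ^ 'n" where p: "balanced_configuration p A k m"
    using exists_balanced_configuration[OF A A' km(1,2)] .
  define Q where "Q = convex hull (range p)"
  have QF: "Q \<in> ?F"
    unfolding Q_def assms(1) by (rule balanced_configuration_inscribed_polytope[OF p A A' km(1,2)])
  have Q: "measure lebesgue Q = V"
    using volume_balanced_configuration[OF p A A' km(1,2)] bound[OF QF]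
    by (simp add: Q_def V_def assms(1))
  have max_iff: "has_maximal_volume P ?F \<longleftrightarrow> P \<in> ?F \<and> measure lebesgue P = V" for P
    unfolding has_maximal_volume_def using QF Q bound by (auto intro: order_antisym)
  have "max_volume TYPE('n) (d + 2) = V"
    unfolding max_volume_def using QF Q bound by (intro Greatest_equality) auto
  also have "V = 1 / fact d *
           ((real k + 1) powr ((real k + 1) / 2) * (real m + 1) powr ((real m + 1) / 2) /
            (real k powr (real k / 2) * real m powr (real m / 2)))"
    by (simp add: V_def simplex_factor_def)
  finally have "max_volume TYPE('n) (d + 2) = \<dots>" .
  moreover have "\<exists>P. has_maximal_volume P ?F"
    using max_iff QF Q by blast
  moreover have "\<exists>P1 P2 U V. P = convex hull (P1 \<union> P2) \<and>
               regular_simplex k P1 \<and> inscribed P1 \<and> P1 \<subseteq> U \<and>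
               regular_simplex m P2 \<and> inscribed P2 \<and> P2 \<subseteq> V \<and>
               orthogonal_subspaces U V"
    if "has_maximal_volume P ?F" for P
  proof -
    have "P \<in> ?F" "measure lebesgue P = V"
      using that max_iff by simp_all
    then obtain p :: "'n + 2 \<Rightarrow> real ^ 'n" and A where P: "P = convex hull (range p)"
      and p: "card A = Suc k" "card (- A) = Suc m" "balanced_configuration p A k m"
      using bound by blast
    show ?thesis
      unfolding P by (rule balanced_configuration_decomposition[OF p(3,1,2) km(1,2)]) blast
  qed
  ultimately show ?thesis
    by blast
qed

end
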